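(* Let $\Lambda$ be a finite, strongly connected $k$-graph and let $\delta\in(0,1)$. If $w_\delta(\lambda)=\operatorname{diam}[\lambda]$ for all $\lambda\in F\mathcal{B}_\Lambda$, where the diameter is taken with respect to $d_\delta$, then the Hausdorff dimension of $(X_{\mathcal{B}_\Lambda},d_\delta)$ is $\delta$.
   Context: $\mathbb{N}=\{0,1,2,\dots\}$. A $k$-graph is a countable small category $\Lambda$ with a functor $d:\Lambda\to\mathbb{N}^k$ ($\mathbb{N}^k$ viewed as a one-object category) satisfying the factorization property: if $d(\lambda)=m+n$, there are unique $\mu,\nu\in\Lambda$ with $d(\mu)=m$, $d(\nu)=n$ and $\lambda=\mu\nu$. $r,s$ denote range and source of morphisms; $\Lambda^n=d^{-1}(n)$; $\Lambda^0$ is the set of vertices. $\Lambda$ is finite if every $\Lambda^n$ is finite, and strongly connected if for all $v,w\in\Lambda^0$ there is a morphism with range $v$ and source $w$. $A_i(v,w)=\#\{\lambda\in\Lambda^{e_i}: r(\lambda)=v,s(\lambda)=w\}$, and $\rho_i$ is the spectral radius of $A_i$. The Perron–Frobenius eigenvector $x^\Lambda\in(0,\infty)^{\Lambda^0}$ is the unique positive vector with $\sum_v x^\Lambda_v=1$ and $A_ix^\Lambda=\rho_ix^\Lambda$ for all $i$. The stationary $k$-Bratteli diagram $\mathcal{B}_\Lambda$ has vertex set $\bigsqcup_{n\ge0}\mathcal{V}_n$, each $\mathcal{V}_n$ a copy of $\Lambda^0$, and edge set $\bigsqcup_{n\ge1}\mathcal{E}_n$; edges in $\mathcal{E}_n$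 have source in $\mathcal{V}_n$ and range in $\mathcal{V}_{n-1}$, and if $n\equiv i\pmod k$ with $1\le i\le k$, there are $A_i(p,q)$ edges with range $p\in\mathcal{V}_{n-1}$ and source $q\in\mathcal{V}_n$. $X_{\mathcal{B}_\Lambda}$ is the set of infinite paths $(x_n)_{n\ge1}$, $x_n\in\mathcal{E}_n$, $s(x_n)=r(x_{n+1})$; $F\mathcal{B}_\Lambda$ is the set of finite paths with range in $\mathcal{V}_0$ (length-$0$ paths being vertices of $\mathcal{V}_0$); $|\eta|$ is length; $[\lambda]$ is the set of infinite paths with initial segment $\lambda$. For $|\eta|=qk+t$ with $q,t\in\mathbb{N}$, $0\le t\le k-1$, $w_\delta(\eta)=\left(\rho_1^{q+1}\cdots\rho_t^{q+1}\rho_{t+1}^q\cdots\rho_k^q\right)^{-1/\delta}x^\Lambda_{s(\eta)}$. The metric $d_\delta$ on $X_{\mathcal{B}_\Lambda}$ is: $d_\delta(x,x)=0$; $d_\delta(x,y)=1$ if $x,y$ have no common initial segment in $F\mathcal{B}_\Lambda$; otherwise $d_\delta(x,y)=w_\delta(x\wedge y)$, $x\wedge y$ being the longest common initial segment. $\operatorname{diam}[\lambda]=\sup\{d_\delta(x,y):x,y\in[\lambda]\}$. For a metric space $X$, $s\ge0$ and compact $Z\subseteq X$, $$H^s(Z)=\lim_{\epsilon\to0}\inf\Big\{\sum_{i\in F}(\operatorname{diam}U_i)^s:\ |F|<\infty,\ \bigcup_{i\in F}U_i=Z,\ \operatorname{diam}U_i<\epsilon\text{ for all }i\Big\}.$$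 The Hausdorff dimension of $X$ is the unique $s$ with $H^t(X)=\infty$ for all $t<s$ and $H^t(X)=0$ for all $t>s$. *)

theory Defs
  imports
    "HOL-Analysis.Abstract_Metric_Spaces"
    "HOL-Library.Countable_Set"
    "HOL-Library.Extended_Nonnegative_Real"
    "Jordan_Normal_Form.Spectral_Radius"
begin

section \<open>Higher-rank graphs\<close>

text \<open>
  A small category is presented by its arrows alone: the objects are identified with the identity
  arrows, so that \<open>rng\<close> and \<open>src\<close> send an arrow to the identity arrow at its range and source. The
  composite \<open>\<mu>\<nu>\<close> is meaningful only if \<open>src \<mu> = rng \<nu>\<close>.
\<close>

record 'm kgraph =
  arrows :: "'m set"
  rng :: "'m \<Rightarrow> 'm"
  src :: "'m \<Rightarrow> 'm"
  cmp :: "'m \<Rightarrow> 'm \<Rightarrow> 'm"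
  deg :: "'m \<Rightarrow> nat \<Rightarrow> nat"

definition small_category :: "('m, 'b) kgraph_scheme \<Rightarrow> bool" where
  "small_category \<Lambda> \<longleftrightarrow>
     (\<forall>f\<in>arrows \<Lambda>. rng \<Lambda> f \<in> arrows \<Lambda> \<and> src \<Lambda> f \<in> arrows \<Lambda> \<and>
        rng \<Lambda> (rng \<Lambda> f) = rng \<Lambda> f \<and> src \<Lambda> (rng \<Lambda> f) = rng \<Lambda> f \<and>
        rng \<Lambda> (src \<Lambda> f) = src \<Lambda> f \<and> src \<Lambda> (src \<Lambda> f) = src \<Lambda> f \<and>
        cmp \<Lambda> (rng \<Lambda> f) f = f \<and> cmp \<Lambda> f (src \<Lambda> f) = f) \<and>
     (\<forall>\<mu>\<in>arrows \<Lambda>. \<forall>\<nu>\<in>arrows \<Lambda>. src \<Lambda> \<mu> = rng \<Lambda> \<nu> \<longrightarrow>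
        cmp \<Lambda> \<mu> \<nu> \<in> arrows \<Lambda> \<and>
        rng \<Lambda> (cmp \<Lambda> \<mu> \<nu>) = rng \<Lambda> \<mu> \<and> src \<Lambda> (cmp \<Lambda> \<mu> \<nu>) = src \<Lambda> \<nu>) \<and>
     (\<forall>\<mu>\<in>arrows \<Lambda>. \<forall>\<nu>\<in>arrows \<Lambda>. \<forall>\<kappa>\<in>arrows \<Lambda>.
        src \<Lambda> \<mu> = rng \<Lambda> \<nu> \<and> src \<Lambda> \<nu> = rng \<Lambda> \<kappa> \<longrightarrow>
        cmp \<Lambda> (cmp \<Lambda> \<mu> \<nu>) \<kappa> = cmp \<Lambda> \<mu> (cmp \<Lambda> \<nu> \<kappa>))"

text \<open>The monoid \<open>\<nat>\<^sup>k\<close>: coordinates are numbered \<open>1, \<dots>, k\<close>, all others vanish.\<close>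

definition Nk :: "nat \<Rightarrow> (nat \<Rightarrow> nat) set" where
  "Nk k = {n. \<forall>i. i \<notin> {1..k} \<longrightarrow> n i = 0}"

definition unit_deg :: "nat \<Rightarrow> nat \<Rightarrow> nat" where
  "unit_deg i = (\<lambda>j. if j = i then 1 else 0)"

definition k_graph :: "nat \<Rightarrow> ('m, 'b) kgraph_scheme \<Rightarrow> bool" where
  "k_graph k \<Lambda> \<longleftrightarrow>
     small_category \<Lambda> \<and> countable (arrows \<Lambda>) \<and>
     (\<forall>f\<in>arrows \<Lambda>. deg \<Lambda> f \<in> Nk k) \<and>
     (\<forall>f\<in>arrows \<Lambda>. deg \<Lambda> (rng \<Lambda> f) = (\<lambda>i. 0) \<and> deg \<Lambda> (src \<Lambda> f) = (\<lambda>i. 0)) \<and>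
     (\<forall>\<mu>\<in>arrows \<Lambda>. \<forall>\<nu>\<in>arrows \<Lambda>. src \<Lambda> \<mu> = rng \<Lambda> \<nu> \<longrightarrow>
        deg \<Lambda> (cmp \<Lambda> \<mu> \<nu>) = (\<lambda>i. deg \<Lambda> \<mu> i + deg \<Lambda> \<nu> i)) \<and>
     (\<forall>f\<in>arrows \<Lambda>. \<forall>m\<in>Nk k. \<forall>n\<in>Nk k. deg \<Lambda> f = (\<lambda>i. m i + n i) \<longrightarrow>
        (\<exists>!(\<mu>, \<nu>). \<mu> \<in> arrows \<Lambda> \<and> \<nu> \<in> arrows \<Lambda> \<and> deg \<Lambda> \<mu> = m \<and> deg \<Lambda> \<nu> = n \<and>
           src \<Lambda> \<mu> = rng \<Lambda> \<nu> \<and> f = cmp \<Lambda> \<mu> \<nu>))"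

definition of_degree :: "('m, 'b) kgraph_scheme \<Rightarrow> (nat \<Rightarrow> nat) \<Rightarrow> 'm set" where
  "of_degree \<Lambda> n = {f \<in> arrows \<Lambda>. deg \<Lambda> f = n}"

definition verts :: "('m, 'b) kgraph_scheme \<Rightarrow> 'm set" where
  "verts \<Lambda> = of_degree \<Lambda> (\<lambda>i. 0)"

definition finite_kgraph :: "nat \<Rightarrow> ('m, 'b) kgraph_scheme \<Rightarrow> bool" where
  "finite_kgraph k \<Lambda> \<longleftrightarrow> (\<forall>n\<in>Nk k. finite (of_degree \<Lambda> n))"

definition strongly_connected :: "('m, 'b) kgraph_scheme \<Rightarrow> bool" where
  "strongly_connected \<Lambda> \<longleftrightarrow>
     (\<forall>v\<in>verts \<Lambda>. \<forall>w\<in>verts \<Lambda>. \<exists>f\<in>arrows \<Lambda>. rng \<Lambda> f = v \<and> src \<Lambda> f = w)"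

section \<open>Vertex matrices and the Perron--Frobenius eigenvector\<close>

definition vmat :: "('m, 'b) kgraph_scheme \<Rightarrow> nat \<Rightarrow> 'm \<Rightarrow> 'm \<Rightarrow> nat" where
  "vmat \<Lambda> i v w = card {f \<in> of_degree \<Lambda> (unit_deg i). rng \<Lambda> f = v \<and> src \<Lambda> f = w}"

text \<open>
  The spectral radius of a square matrix indexed by a finite set \<open>V\<close>. Matrices in the library are
  indexed by initial segments of the naturals, so \<open>V\<close> is enumerated first; another enumeration gives
  a conjugate matrix and hence the same spectral radius.
\<close>

definition enumeration :: "'v set \<Rightarrow> 'v list" where
  "enumeration V = (SOME vs. distinct vs \<and> set vs = V)"

definition spectral_radius_on :: "'v set \<Rightarrow> ('v \<Rightarrow> 'v \<Rightarrow> nat) \<Rightarrow> real" where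
  "spectral_radius_on V A =
     spectral_radius (mat (card V) (card V)
       (\<lambda>(a, b). of_nat (A (enumeration V ! a) (enumeration V ! b))))"

definition rho :: "('m, 'b) kgraph_scheme \<Rightarrow> nat \<Rightarrow> real" where
  "rho \<Lambda> i = spectral_radius_on (verts \<Lambda>) (vmat \<Lambda> i)"

text \<open>Vectors indexed by \<open>verts \<Lambda>\<close> are functions that vanish elsewhere.\<close>

definition pf_vec :: "nat \<Rightarrow> ('m, 'b) kgraph_scheme \<Rightarrow> 'm \<Rightarrow> real" where
  "pf_vec k \<Lambda> = (THE x.
     (\<forall>v\<in>verts \<Lambda>. 0 < x v) \<and> (\<forall>v. v \<notin> verts \<Lambda> \<longrightarrow> x v = 0) \<and>
     (\<Sum>v\<in>verts \<Lambda>. x v) = 1 \<and>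
     (\<forall>i\<in>{1..k}. \<forall>v\<in>verts \<Lambda>. (\<Sum>w\<in>verts \<Lambda>. real (vmat \<Lambda> i v w) * x w) = rho \<Lambda> i * x v))"

section \<open>The stationary Bratteli diagram\<close>

text \<open>
  \<open>Edge n p q j\<close> is the \<open>j\<close>-th edge (counting from \<open>0\<close>) in \<open>\<E>\<^sub>n\<close> with range \<open>p \<in> \<V>\<^sub>n\<^sub>-\<^sub>1\<close> and source
  \<open>q \<in> \<V>\<^sub>n\<close>; the copy of a vertex \<open>v\<close> in \<open>\<V>\<^sub>n\<close> is the pair \<open>(n, v)\<close>.
\<close>

datatype 'v edge = Edge nat 'v 'v nat

fun edge_rng :: "'v edge \<Rightarrow> nat \<times> 'v" where
  "edge_rng (Edge n p q j) = (n - 1, p)"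

fun edge_src :: "'v edge \<Rightarrow> nat \<times> 'v" where
  "edge_src (Edge n p q j) = (n, q)"

definition bvert :: "('m, 'b) kgraph_scheme \<Rightarrow> nat \<Rightarrow> (nat \<times> 'm) set" where
  "bvert \<Lambda> n = {n} \<times> verts \<Lambda>"

text \<open>The representative of \<open>n\<close> modulo \<open>k\<close> in \<open>{1..k}\<close>, for \<open>n \<ge> 1\<close>.\<close>

definition colour :: "nat \<Rightarrow> nat \<Rightarrow> nat" where
  "colour k n = (n - 1) mod k + 1"

definition bedge :: "nat \<Rightarrow> ('m, 'b) kgraph_scheme \<Rightarrow> nat \<Rightarrow> 'm edge set" where
  "bedge k \<Lambda> n =
     {Edge n p q j | p q j. p \<in> verts \<Lambda> \<and> q \<in> verts \<Lambda> \<and> j < vmat \<Lambda> (colour k n) p q}"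

text \<open>Paths are indexed from \<open>0\<close>: the edge \<open>x\<^sub>n \<in> \<E>\<^sub>n\<close> of a path is \<open>x (n - 1)\<close>.\<close>

definition inf_paths :: "nat \<Rightarrow> ('m, 'b) kgraph_scheme \<Rightarrow> (nat \<Rightarrow> 'm edge) set" where
  "inf_paths k \<Lambda> =
     {x. \<forall>n. x n \<in> bedge k \<Lambda> (Suc n) \<and> edge_src (x n) = edge_rng (x (Suc n))}"

text \<open>
  A finite path is a pair of its range in \<open>\<V>\<^sub>0\<close> and its list of edges; the range is recorded
  separately because paths of length \<open>0\<close> are vertices.
\<close>

type_synonym 'v bpath = "(nat \<times> 'v) \<times> 'v edge list"

definition fin_paths :: "nat \<Rightarrow> ('m, 'b) kgraph_scheme \<Rightarrow> 'm bpath set" where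
  "fin_paths k \<Lambda> =
     {(v, es). v \<in> bvert \<Lambda> 0 \<and>
        (\<forall>j < length es. es ! j \<in> bedge k \<Lambda> (Suc j)) \<and>
        (es \<noteq> [] \<longrightarrow> edge_rng (hd es) = v) \<and>
        (\<forall>j. Suc j < length es \<longrightarrow> edge_src (es ! j) = edge_rng (es ! Suc j))}"

definition path_length :: "'v bpath \<Rightarrow> nat" where
  "path_length \<eta> = length (snd \<eta>)"

definition path_src :: "'v bpath \<Rightarrow> nat \<times> 'v" where
  "path_src \<eta> = (if snd \<eta> = [] then fst \<eta> else edge_src (last (snd \<eta>)))"

definition cylinder :: "nat \<Rightarrow> ('m, 'b) kgraph_scheme \<Rightarrow> 'm bpath \<Rightarrow> (nat \<Rightarrow> 'm edge) set" where
  "cylinder k \<Lambda> \<eta> =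
     {x \<in> inf_paths k \<Lambda>. edge_rng (x 0) = fst \<eta> \<and>
        (\<forall>j < path_length \<eta>. x j = snd \<eta> ! j)}"

section \<open>The weight and the ultrametric\<close>

definition weight :: "nat \<Rightarrow> ('m, 'b) kgraph_scheme \<Rightarrow> real \<Rightarrow> 'm bpath \<Rightarrow> real" where
  "weight k \<Lambda> \<delta> \<eta> =
     (let q = path_length \<eta> div k; t = path_length \<eta> mod k in
       ((\<Prod>i\<in>{1..t}. rho \<Lambda> i ^ (q + 1)) * (\<Prod>i\<in>{t+1..k}. rho \<Lambda> i ^ q)) powr (- 1 / \<delta>) *
       pf_vec k \<Lambda> (snd (path_src \<eta>)))"

definition common_segments ::
    "nat \<Rightarrow> ('m, 'b) kgraph_scheme \<Rightarrow> (nat \<Rightarrow> 'm edge) \<Rightarrow> (nat \<Rightarrow> 'm edge) \<Rightarrow> 'm bpath set" where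
  "common_segments k \<Lambda> x y = {\<eta> \<in> fin_paths k \<Lambda>. x \<in> cylinder k \<Lambda> \<eta> \<and> y \<in> cylinder k \<Lambda> \<eta>}"

definition path_meet ::
    "nat \<Rightarrow> ('m, 'b) kgraph_scheme \<Rightarrow> (nat \<Rightarrow> 'm edge) \<Rightarrow> (nat \<Rightarrow> 'm edge) \<Rightarrow> 'm bpath" where
  "path_meet k \<Lambda> x y =
     (THE \<eta>. \<eta> \<in> common_segments k \<Lambda> x y \<and>
        (\<forall>\<zeta>\<in>common_segments k \<Lambda> x y. path_length \<zeta> \<le> path_length \<eta>))"

definition path_dist ::
    "nat \<Rightarrow> ('m, 'b) kgraph_scheme \<Rightarrow> real \<Rightarrow> (nat \<Rightarrow> 'm edge) \<Rightarrow> (nat \<Rightarrow> 'm edge) \<Rightarrow> real" where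
  "path_dist k \<Lambda> \<delta> x y =
     (if x = y then 0
      else if common_segments k \<Lambda> x y = {} then 1
      else weight k \<Lambda> \<delta> (path_meet k \<Lambda> x y))"

section \<open>Hausdorff dimension\<close>

context Metric_space
begin

text \<open>
  Diameters take values in \<open>[0, \<infinity>]\<close>; the empty set has diameter \<open>0\<close>. The name \<open>d\<close> is the metric
  fixed by the locale.
\<close>

definition mdiam :: "'a set \<Rightarrow> ennreal" where
  "mdiam U = (SUP x\<in>U. SUP y\<in>U. ennreal (d x y))"

text \<open>
  With the convention \<open>0\<^sup>0 = 1\<close>, whereas \<open>0 powr 0 = 0\<close>. Only used for sets of finite diameter.
\<close>

definition mdiam_powr :: "'a set \<Rightarrow> real \<Rightarrow> ennreal" where
  "mdiam_powr U s = (if s = 0 then 1 else ennreal (enn2real (mdiam U) powr s))"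

definition hausdorff_pre :: "real \<Rightarrow> real \<Rightarrow> 'a set \<Rightarrow> ennreal" where
  "hausdorff_pre s \<epsilon> Z =
     Inf {(\<Sum>i\<in>F. mdiam_powr (U i) s) | (F :: nat set) U.
            finite F \<and> (\<Union>i\<in>F. U i) = Z \<and> (\<forall>i\<in>F. mdiam (U i) < ennreal \<epsilon>)}"

definition hausdorff_meas :: "real \<Rightarrow> 'a set \<Rightarrow> ennreal" where
  "hausdorff_meas s Z = Lim (at_right 0) (\<lambda>\<epsilon>. hausdorff_pre s \<epsilon> Z)"

definition critical_exponent :: "real \<Rightarrow> bool" where
  "critical_exponent s \<longleftrightarrow>
     0 \<le> s \<and>
     (\<forall>t. 0 \<le> t \<and> t < s \<longrightarrow> hausdorff_meas t M = \<infinity>) \<and>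
     (\<forall>t > s. hausdorff_meas t M = 0)"

definition has_hausdorff_dimension :: "real \<Rightarrow> bool" where
  "has_hausdorff_dimension s \<longleftrightarrow>
     critical_exponent s \<and> (\<forall>s'. critical_exponent s' \<longrightarrow> s' = s)"

end

end

theory Submission
  imports Defs "HOL-Analysis.Function_Topology" "HOL-Real_Asymp.Real_Asymp"
begin

text \<open>
  For a finite path \<open>\<eta>\<close> put \<open>M \<eta> = x (s \<eta>) / P\<close>, where \<open>x\<close> is the Perron--Frobenius eigenvector and \<open>P\<close>
  is the product of spectral radii in the definition of the weight. The eigenvalue equations make
  \<open>M\<close> a finitely additive probability on cylinders, and \<open>M \<le> w\<^sup>\<delta> \<le> C M\<close> since the entries of \<open>x\<close> lie
  between a positive constant and \<open>1\<close>. The hypothesis that weights are diameters makes them decrease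
  along paths, and gives every cylinder two points, so that \<open>\<rho>\<^sub>1 \<cdots> \<rho>\<^sub>k > 1\<close> and weights tend
  to \<open>0\<close>. Covers by cylinders of a fixed length then bound the dimension from above. From below, a
  set with two points lies in a cylinder of no larger weight, so mass distribution applies;
  singletons lie in cylinders of arbitrarily small mass.
\<close>

unbundle no vec_syntax

section \<open>Perron--Frobenius theory\<close>

text \<open>\<open>pf_vec\<close> is a definite description and \<open>rho\<close> a spectral
  radius, so the eigenvalue equations themselves have to be earned. The obstacle is that a single
  vertex matrix may be reducible although the graph is strongly connected. Only a suitable sum of
  path count matrices is entrywise positive; unique factorisation makes all these matrices commute,
  which carries the one-dimensional positive eigenspace of the sum over to every vertex matrix.

  A finite cover by cylinders can be refined to paths of one common length, where additivity of
  \<open>mass\<close> is a finite sum; hence no measure on the space of infinite paths has to be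
  constructed.

  The distance is not given as a metric either. Its triangle inequality rests on weights decreasing
  along paths, which is read off from the diameters of nested cylinders, so the order of the results
  is: weights, positivity of the spectral radii, mass, metric, growth.\<close>

definition mv :: "'a set \<Rightarrow> ('a \<Rightarrow> 'a \<Rightarrow> real) \<Rightarrow> ('a \<Rightarrow> real) \<Rightarrow> 'a \<Rightarrow> real" where
  "mv V A x v = (\<Sum>w\<in>V. A v w * x w)"

text \<open>Tychonoff: the simplex is a closed slice of a product of compact sets. Fixing the
  coordinates outside \<open>V\<close> to 0 is what makes every factor compact when the index type
  is larger than \<open>V\<close>.\<close>

lemma compact_std_simplex:
  fixes V :: "'a set"
  assumes "finite V"
  shows "compact {x. (\<forall>v\<in>V. 0 \<le> x v) \<and> (\<forall>v. v \<notin> V \<longrightarrow> x v = 0) \<and> sum x V = (1::real)}"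
    (is "compact ?K")
proof -
  let ?S = "Pi\<^sub>E UNIV (\<lambda>v. if v \<in> V then {0..1::real} else {0})"
  have "compactin (product_topology (\<lambda>_::'a. euclidean) UNIV) ?S"
    by (subst compactin_PiE) auto
  then have "compact ?S"
    by (simp only: euclidean_product_topology compactin_euclidean_iff)
  moreover have "closed {x::'a \<Rightarrow> real. sum x V = 1}"
    by (intro closed_Collect_eq continuous_on_sum continuous_on_product_coordinates continuous_on_const)
  moreover have "?K = ?S \<inter> {x. sum x V = 1}"
  proof (intro equalityI subsetI)
    fix x assume x: "x \<in> ?K"
    then have "x v \<le> 1" if "v \<in> V" for v
      using member_le_sum[of v V x] that assms by auto
    with x show "x \<in> ?S \<inter> {x. sum x V = 1}" by auto
  next
    fix x assume x: "x \<in> ?S \<inter> {x. sum x V = 1}"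
    have "x v \<in> (if v \<in> V then {0..1::real} else {0})" for v
      using x by (auto simp: PiE_iff)
    then have "(v \<in> V \<longrightarrow> 0 \<le> x v) \<and> (v \<notin> V \<longrightarrow> x v = 0)" for v
      by (cases "v \<in> V") (metis atLeastAtMost_iff singletonD)+
    with x show "x \<in> ?K" by auto
  qed
  ultimately show ?thesis by (simp add: compact_Int_closed)
qed

lemma continuous_on_Min_family:
  fixes f :: "'i \<Rightarrow> 'a::topological_space \<Rightarrow> real"
  assumes "finite I" "I \<noteq> {}" "\<And>i. i \<in> I \<Longrightarrow> continuous_on S (f i)"
  shows "continuous_on S (\<lambda>x. Min ((\<lambda>i. f i x) ` I))"
  using assms
proof (induction I rule: finite_ne_induct)
  case (insert i I)
  then have "continuous_on S (\<lambda>x. min (f i x) (Min ((\<lambda>i. f i x) ` I)))"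
    by (intro continuous_on_min) auto
  with insert show ?case by (simp add: Min_insert)
qed auto

lemma mv_pos:
  assumes "finite V" "\<And>v w. v \<in> V \<Longrightarrow> w \<in> V \<Longrightarrow> 0 < A v w"
    and "\<And>v. v \<in> V \<Longrightarrow> 0 \<le> x v" "u \<in> V" "x u \<noteq> 0" "v \<in> V"
  shows "0 < mv V A x v"
proof -
  have "0 < A v u * x u" using assms by (auto simp: less_le)
  also have "\<dots> \<le> mv V A x v" unfolding mv_def
    using assms by (intro member_le_sum) (auto intro!: mult_nonneg_nonneg simp: less_imp_le)
  finally show ?thesis .
qed

lemma mv_scale: "mv V A (\<lambda>v. c * x v) u = c * mv V A x u"
  by (simp add: mv_def sum_distrib_left algebra_simps)

lemma mv_diff: "mv V A (\<lambda>v. x v - y v) u = mv V A x u - mv V A y u"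
  by (simp add: mv_def sum_subtractf algebra_simps)

lemma mv_mv:
  "finite V \<Longrightarrow> mv V A (mv V B x) v = mv V (\<lambda>v w. \<Sum>u\<in>V. A v u * B u w) x v"
  unfolding mv_def
  by (simp add: sum_distrib_left sum_distrib_right mult.assoc)
    (rule sum.swap)

lemma mv_cong: "(\<And>w. w \<in> V \<Longrightarrow> x w = y w) \<Longrightarrow> mv V A x v = mv V A y v"
  by (simp add: mv_def)

text \<open>
  The minimum of the quotients \<open>(B B x)\<^sub>v / (B x)\<^sub>v\<close> is continuous on the simplex because \<open>B x\<close> is
  positive there; at a maximiser \<open>x\<close> the vector \<open>B x\<close> is an eigenvector, as otherwise another
  application of \<open>B\<close> would increase the minimum.
\<close>

lemma positive_matrix_eigenvector:
  fixes B :: "'a \<Rightarrow> 'a \<Rightarrow> real"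
  assumes fin: "finite V" and ne: "V \<noteq> {}"
    and pos_all: "\<forall>v\<in>V. \<forall>w\<in>V. 0 < B v w"
  shows "\<exists>x r. (\<forall>v\<in>V. 0 < x v) \<and> (\<forall>v\<in>V. mv V B x v = r * x v)"
proof -
  have pos: "\<And>v w. v \<in> V \<Longrightarrow> w \<in> V \<Longrightarrow> 0 < B v w" using pos_all by blast
  define K where "K = {x. (\<forall>v\<in>V. 0 \<le> x v) \<and> (\<forall>v. v \<notin> V \<longrightarrow> x v = 0) \<and> sum x V = (1::real)}"
  define g where "g x = Min ((\<lambda>v. mv V B (mv V B x) v / mv V B x v) ` V)" for x
  have Bpos: "0 < mv V B x v" if x: "x \<in> K" and v: "v \<in> V" for x v
  proof -
    have "sum x V \<noteq> 0" using x by (simp add: K_def)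
    then obtain u where "u \<in> V" "x u \<noteq> 0" by (meson sum.neutral)
    then show ?thesis using x by (intro mv_pos[OF fin pos _ _ _ v]) (simp_all add: K_def)
  qed
  have cont: "continuous_on K g"
    unfolding g_def
  proof (rule continuous_on_Min_family[OF fin ne])
    fix v assume v: "v \<in> V"
    have cB: "continuous_on K (\<lambda>x. mv V B (f x) u)" if "\<And>w. continuous_on K (\<lambda>x. f x w)" for f u
      unfolding mv_def by (intro continuous_on_sum continuous_on_mult continuous_on_const that)
    have c: "continuous_on K (\<lambda>x. x w)" for w
      by (rule continuous_on_subset[OF continuous_on_product_coordinates]) simp
    show "continuous_on K (\<lambda>x. mv V B (mv V B x) v / mv V B x v)"
    proof (rule continuous_on_divide)
      show "\<forall>x\<in>K. mv V B x v \<noteq> 0" using Bpos[OF _ v] by (metis less_irrefl)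
    qed (intro cB c)+
  qed
  obtain v0 where v0: "v0 \<in> V" using ne by auto
  have "(\<lambda>v. if v = v0 then 1 else 0) \<in> K"
    using v0 fin by (auto simp: K_def)
  then have "K \<noteq> {}" by auto
  moreover have "compact K" unfolding K_def by (rule compact_std_simplex[OF fin])
  ultimately obtain x where x: "x \<in> K" and max: "\<And>y. y \<in> K \<Longrightarrow> g y \<le> g x"
    using continuous_attains_sup[OF _ _ cont] by blast
  define y where "y = mv V B x"
  define r where "r = g x"
  have ypos: "0 < y v" if "v \<in> V" for v using Bpos[OF x that] by (simp add: y_def)
  have ge: "r * y v \<le> mv V B y v" if "v \<in> V" for v
  proof -
    have "r \<le> mv V B y v / y v" unfolding r_def g_def y_def
      using that fin by (intro Min_le) auto
    then show ?thesis using ypos[OF that] by (simp add: pos_le_divide_eq)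
  qed
  have "mv V B y v = r * y v" if v: "v \<in> V" for v
  proof (rule ccontr)
    assume neq: "mv V B y v \<noteq> r * y v"
    define s where "s = sum y V"
    have s: "s > 0" unfolding s_def using ypos fin ne by (intro sum_pos) auto
    \<comment> \<open>The quotients in \<open>g\<close> are invariant under scaling, so
      \<open>y\<close> may be pushed back into the simplex. Entries off \<open>V\<close> are reset
      because \<open>mv\<close> takes arbitrary values there.\<close>
    define x' where "x' = (\<lambda>v. if v \<in> V then inverse s * y v else 0)"
    have x': "x' \<in> K"
      using s by (simp add: K_def x'_def ypos less_imp_le sum_distrib_left[symmetric] s_def[symmetric])
    have Bx': "mv V B x' u = inverse s * mv V B y u" for u
      by (subst mv_scale[symmetric]) (rule mv_cong, simp add: x'_def)
    have BBx': "mv V B (mv V B x') u = inverse s * mv V B (mv V B y) u" for u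
      by (subst mv_scale[symmetric]) (rule mv_cong, simp add: Bx')
    have "r < mv V B (mv V B x') u / mv V B x' u" if u: "u \<in> V" for u
    proof -
      have "0 < mv V B (\<lambda>w. mv V B y w - r * y w) u"
        by (rule mv_pos[OF fin pos _ v _ u]) (use neq ge in auto)
      then have "r * mv V B y u < mv V B (mv V B y) u"
        by (simp add: mv_diff mv_scale)
      moreover have "0 < mv V B y u"
        by (rule mv_pos[OF fin pos _ v _ u]) (use ypos[OF v] in \<open>simp_all add: less_imp_le ypos\<close>)
      ultimately show ?thesis
        using s by (simp add: Bx' BBx' pos_less_divide_eq)
    qed
    then have "r < g x'" unfolding g_def using fin ne by (subst Min_gr_iff) auto
    with max[OF x'] show False by (simp add: r_def)
  qed
  with ypos show ?thesis by blast
qed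

text \<open>Subtract from \<open>y\<close> the largest multiple of \<open>x\<close> that leaves a
  nonnegative vector \<open>z\<close>. It vanishes at some \<open>u\<close>, whereas a positive
  matrix sends a nonzero nonnegative vector to one without zeros; as \<open>z\<close> has the same
  eigenvalue, \<open>z\<close> must be 0. The sign of \<open>y\<close> is arbitrary.\<close>

lemma positive_matrix_eigenvector_unique:
  fixes B :: "'a \<Rightarrow> 'a \<Rightarrow> real"
  assumes fin: "finite V" and ne: "V \<noteq> {}"
    and pos_all: "\<forall>v\<in>V. \<forall>w\<in>V. 0 < B v w"
    and x_all: "\<forall>v\<in>V. 0 < x v" "\<forall>v\<in>V. mv V B x v = r * x v"
    and y_all: "\<forall>v\<in>V. mv V B y v = r * y v"
  shows "\<exists>c. \<forall>v\<in>V. y v = c * x v"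
proof -
  have pos: "\<And>v w. v \<in> V \<Longrightarrow> w \<in> V \<Longrightarrow> 0 < B v w" using pos_all by blast
  have x: "\<And>v. v \<in> V \<Longrightarrow> 0 < x v" "\<And>v. v \<in> V \<Longrightarrow> mv V B x v = r * x v"
    and y: "\<And>v. v \<in> V \<Longrightarrow> mv V B y v = r * y v"
    using x_all y_all by blast+
  define c where "c = Min ((\<lambda>v. y v / x v) ` V)"
  define z where "z = (\<lambda>v. y v - c * x v)"
  have "c \<in> (\<lambda>v. y v / x v) ` V" unfolding c_def using fin ne by (intro Min_in) auto
  then obtain u where u: "u \<in> V" "c = y u / x u" by auto
  have zu: "z u = 0" using u x(1)[OF u(1)] by (simp add: z_def)
  have zn: "0 \<le> z v" if "v \<in> V" for v
  proof -
    have "c \<le> y v / x v" unfolding c_def using that fin by (intro Min_le) auto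
    then show ?thesis using x(1)[OF that] by (simp add: z_def pos_le_divide_eq)
  qed
  have Bz: "mv V B z u = r * z u"
    using x(2)[OF u(1)] y[OF u(1)] by (simp add: z_def mv_diff mv_scale algebra_simps)
  have "z v = 0" if v: "v \<in> V" for v
  proof (rule ccontr)
    assume "z v \<noteq> 0"
    then have "0 < mv V B z u" by (intro mv_pos[OF fin pos zn v _ u(1)])
    with Bz zu show False by simp
  qed
  then show ?thesis by (intro exI[of _ c]) (simp add: z_def)
qed

text \<open>Irreducibility is irrelevant once a positive eigenvector \<open>x\<close> is known: in
  the sup norm weighted by \<open>x\<close>, a nonnegative matrix with eigenvalue \<open>r\<close>
  at \<open>x\<close> has operator norm at most \<open>r\<close>. Concretely, the triangle
  inequality is applied to a complex eigenvector at the index where the ratio of its modulus to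
  \<open>x\<close> is largest.\<close>

lemma spectral_radius_on_eqI:
  fixes A :: "'a \<Rightarrow> 'a \<Rightarrow> nat"
  assumes fin: "finite V" and ne: "V \<noteq> {}"
    and x: "\<And>v. v \<in> V \<Longrightarrow> 0 < x v" "\<And>v. v \<in> V \<Longrightarrow> mv V (\<lambda>v w. real (A v w)) x v = r * x v"
  shows "spectral_radius_on V A = r"
proof -
  define vs where "vs = enumeration V"
  define n where "n = card V"
  have "\<exists>vs. distinct vs \<and> set vs = V" using finite_distinct_list[OF fin] by blast
  then have vs: "distinct vs" "set vs = V"
    unfolding vs_def enumeration_def by (metis (mono_tags, lifting) someI_ex)+
  have len: "length vs = n" using vs by (metis distinct_card n_def)
  have n0: "n > 0" using fin ne by (simp add: n_def card_gt_0_iff)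
  have bij: "bij_betw ((!) vs) {0..<n} V"
    using bij_betw_nth[OF vs(1), of "{0..<n}" V] vs(2) len by (simp add: atLeast0LessThan)
  have vsV: "vs ! a \<in> V" if "a < n" for a using that len vs(2) by auto
  define M where "M = mat n n (\<lambda>(a, b). complex_of_nat (A (vs ! a) (vs ! b)))"
  have M: "M \<in> carrier_mat n n" by (simp add: M_def)
  have sr: "spectral_radius_on V A = spectral_radius M"
    by (simp add: spectral_radius_on_def M_def n_def vs_def)
  have Mv: "(M *\<^sub>v y) $ a = (\<Sum>b\<in>{0..<n}. of_nat (A (vs ! a) (vs ! b)) * y $ b)"
    if "a < n" "y \<in> carrier_vec n" for a y
    using that by (auto simp: M_def scalar_prod_def intro!: sum.cong)
  have r0: "r \<ge> 0"
  proof -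
    obtain v where v: "v \<in> V" using ne by auto
    have "0 \<le> mv V (\<lambda>v w. real (A v w)) x v" unfolding mv_def
      by (intro sum_nonneg mult_nonneg_nonneg) (auto simp: x(1) less_imp_le)
    then show ?thesis using x(1)[OF v] x(2)[OF v] by (simp add: zero_le_mult_iff)
  qed
  have ev: "eigenvalue M (complex_of_real r)"
  proof -
    define y where "y = vec n (\<lambda>a. complex_of_real (x (vs ! a)))"
    have y: "y \<in> carrier_vec n" by (simp add: y_def)
    have "y $ 0 \<noteq> 0" using n0 x(1)[OF vsV[OF n0]] by (simp add: y_def)
    then have "y \<noteq> 0\<^sub>v n" using n0 by auto
    moreover have "M *\<^sub>v y = complex_of_real r \<cdot>\<^sub>v y"
    proof (rule eq_vecI)
      fix a assume "a < dim_vec (complex_of_real r \<cdot>\<^sub>v y)"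
      then have a: "a < n" by (simp add: y_def)
      have "(M *\<^sub>v y) $ a = (\<Sum>b\<in>{0..<n}. complex_of_real (real (A (vs ! a) (vs ! b)) * x (vs ! b)))"
        using Mv[OF a y] by (simp add: y_def)
      also have "\<dots> = complex_of_real (\<Sum>b\<in>{0..<n}. real (A (vs ! a) (vs ! b)) * x (vs ! b))"
        by simp
      also have "(\<Sum>b\<in>{0..<n}. real (A (vs ! a) (vs ! b)) * x (vs ! b)) = mv V (\<lambda>v w. real (A v w)) x (vs ! a)"
        unfolding mv_def
        by (rule sum.reindex_bij_betw[OF bij, of "\<lambda>w. real (A (vs ! a) w) * x w"])
      finally show "(M *\<^sub>v y) $ a = (complex_of_real r \<cdot>\<^sub>v y) $ a"
        using x(2)[OF vsV[OF a]] a by (simp add: y_def)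
    qed (use M in \<open>auto simp: y_def\<close>)
    ultimately show ?thesis using M y unfolding eigenvalue_def eigenvector_def by auto
  qed
  have le: "cmod e \<le> r" if "eigenvalue M e" for e
  proof -
    from that obtain y where y: "y \<in> carrier_vec n" "y \<noteq> 0\<^sub>v n" "M *\<^sub>v y = e \<cdot>\<^sub>v y"
      using M unfolding eigenvalue_def eigenvector_def by auto
    let ?q = "\<lambda>a. cmod (y $ a) / x (vs ! a)"
    define c where "c = Max (?q ` {0..<n})"
    have "c \<in> ?q ` {0..<n}" unfolding c_def using n0 by (intro Max_in) auto
    then obtain a where a: "a < n" "c = ?q a" by auto
    have yle: "cmod (y $ b) \<le> c * x (vs ! b)" if "b < n" for b
    proof -
      have "?q b \<le> c" unfolding c_def using that by (intro Max_ge) auto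
      then show ?thesis using x(1)[OF vsV[OF that]] by (simp add: pos_divide_le_eq)
    qed
    have xa: "0 < x (vs ! a)" using x(1) vsV a by blast
    obtain b where b: "b < n" "y $ b \<noteq> 0" using y(1,2) by (metis eq_vecI carrier_vecD index_zero_vec)
    have "0 < cmod (y $ b)" using b by simp
    also have "\<dots> \<le> c * x (vs ! b)" by (rule yle[OF b(1)])
    finally have c0: "0 < c" using x(1)[OF vsV[OF b(1)]] by (simp add: zero_less_mult_iff)
    have "cmod e * (c * x (vs ! a)) = cmod (e * y $ a)"
      using xa a by (simp add: norm_mult)
    also have "e * y $ a = (M *\<^sub>v y) $ a" using y a by simp
    also have "\<dots> = (\<Sum>b\<in>{0..<n}. of_nat (A (vs ! a) (vs ! b)) * y $ b)" by (rule Mv[OF a(1) y(1)])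
    also have "cmod \<dots> \<le> (\<Sum>b\<in>{0..<n}. real (A (vs ! a) (vs ! b)) * (c * x (vs ! b)))"
    proof (rule sum_norm_le)
      fix b assume "b \<in> {0..<n}"
      then show "cmod (of_nat (A (vs ! a) (vs ! b)) * y $ b) \<le> real (A (vs ! a) (vs ! b)) * (c * x (vs ! b))"
        using yle[of b] by (simp add: norm_mult mult_left_mono)
    qed
    also have "\<dots> = c * (\<Sum>b\<in>{0..<n}. real (A (vs ! a) (vs ! b)) * x (vs ! b))"
      by (simp add: sum_distrib_left algebra_simps)
    also have "(\<Sum>b\<in>{0..<n}. real (A (vs ! a) (vs ! b)) * x (vs ! b)) = mv V (\<lambda>v w. real (A v w)) x (vs ! a)"
      unfolding mv_def
      by (rule sum.reindex_bij_betw[OF bij, of "\<lambda>w. real (A (vs ! a) w) * x w"])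
    also have "c * mv V (\<lambda>v w. real (A v w)) x (vs ! a) = r * (c * x (vs ! a))"
      using x(2)[OF vsV[OF a(1)]] by simp
    finally show ?thesis using c0 xa by simp
  qed
  show ?thesis
  proof (rule antisym)
    show "spectral_radius_on V A \<le> r"
      using spectral_radius_mem_max(1)[OF M n0] le unfolding sr spectrum_def by auto
    show "r \<le> spectral_radius_on V A"
      unfolding sr using ev r0
      by (intro spectral_radius_mem_max(2)[OF M n0] image_eqI[of _ _ "complex_of_real r"])
        (auto simp: spectrum_def)
  qed
qed

section \<open>Path counts in a higher-rank graph\<close>

text \<open>By \<open>path_count_add\<close> these are the entries of the product of the powers of
  the vertex matrices with exponents \<open>n 1\<close>, ..., \<open>n k\<close>.\<close>

definition path_count :: "('m, 'b) kgraph_scheme \<Rightarrow> (nat \<Rightarrow> nat) \<Rightarrow> 'm \<Rightarrow> 'm \<Rightarrow> nat" where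
  "path_count \<Lambda> n v w = card {f \<in> of_degree \<Lambda> n. rng \<Lambda> f = v \<and> src \<Lambda> f = w}"

lemma vmat_path_count: "vmat \<Lambda> i = path_count \<Lambda> (unit_deg i)"
  by (simp add: vmat_def path_count_def fun_eq_iff)

lemma Nk_zero: "(\<lambda>i. 0) \<in> Nk k"
  by (simp add: Nk_def)

lemma Nk_unit_deg: "i \<in> {1..k} \<Longrightarrow> unit_deg i \<in> Nk k"
  by (auto simp: Nk_def unit_deg_def)

context
  fixes k :: nat and \<Lambda> :: "('m, 'b) kgraph_scheme"
  assumes kg: "k_graph k \<Lambda>"
begin

lemma arrow_closed:
  assumes "f \<in> arrows \<Lambda>"
  shows "rng \<Lambda> f \<in> arrows \<Lambda>" "src \<Lambda> f \<in> arrows \<Lambda>" "src \<Lambda> (rng \<Lambda> f) = rng \<Lambda> f"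
    "rng \<Lambda> (src \<Lambda> f) = src \<Lambda> f"
    "cmp \<Lambda> (rng \<Lambda> f) f = f" "cmp \<Lambda> f (src \<Lambda> f) = f"
    "deg \<Lambda> f \<in> Nk k" "deg \<Lambda> (rng \<Lambda> f) = (\<lambda>i. 0)" "deg \<Lambda> (src \<Lambda> f) = (\<lambda>i. 0)"
  using kg assms unfolding k_graph_def small_category_def by simp_all

lemma cmp_closed:
  assumes "\<mu> \<in> arrows \<Lambda>" "\<nu> \<in> arrows \<Lambda>" "src \<Lambda> \<mu> = rng \<Lambda> \<nu>"
  shows "cmp \<Lambda> \<mu> \<nu> \<in> arrows \<Lambda>" "rng \<Lambda> (cmp \<Lambda> \<mu> \<nu>) = rng \<Lambda> \<mu>" "src \<Lambda> (cmp \<Lambda> \<mu> \<nu>) = src \<Lambda> \<nu>"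
    "deg \<Lambda> (cmp \<Lambda> \<mu> \<nu>) = (\<lambda>i. deg \<Lambda> \<mu> i + deg \<Lambda> \<nu> i)"
  using kg assms unfolding k_graph_def small_category_def by simp_all

lemma factorization_ex1:
  assumes "f \<in> arrows \<Lambda>" "m \<in> Nk k" "n \<in> Nk k" "deg \<Lambda> f = (\<lambda>i. m i + n i)"
  shows "\<exists>!(\<mu>, \<nu>). \<mu> \<in> arrows \<Lambda> \<and> \<nu> \<in> arrows \<Lambda> \<and> deg \<Lambda> \<mu> = m \<and> deg \<Lambda> \<nu> = n \<and>
           src \<Lambda> \<mu> = rng \<Lambda> \<nu> \<and> f = cmp \<Lambda> \<mu> \<nu>"
  using kg assms unfolding k_graph_def by (elim conjE) simp

lemma factorization:
  assumes "f \<in> arrows \<Lambda>" "m \<in> Nk k" "n \<in> Nk k" "deg \<Lambda> f = (\<lambda>i. m i + n i)"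
  obtains \<mu> \<nu> where "\<mu> \<in> arrows \<Lambda>" "\<nu> \<in> arrows \<Lambda>" "deg \<Lambda> \<mu> = m" "deg \<Lambda> \<nu> = n"
    "src \<Lambda> \<mu> = rng \<Lambda> \<nu>" "f = cmp \<Lambda> \<mu> \<nu>"
  using ex1_implies_ex[OF factorization_ex1[OF assms]] by (auto intro: that)

lemma factorization_unique:
  assumes "\<mu> \<in> arrows \<Lambda>" "\<nu> \<in> arrows \<Lambda>" "src \<Lambda> \<mu> = rng \<Lambda> \<nu>"
    and "\<mu>' \<in> arrows \<Lambda>" "\<nu>' \<in> arrows \<Lambda>" "src \<Lambda> \<mu>' = rng \<Lambda> \<nu>'"
    and "deg \<Lambda> \<mu>' = deg \<Lambda> \<mu>" "deg \<Lambda> \<nu>' = deg \<Lambda> \<nu>" "cmp \<Lambda> \<mu>' \<nu>' = cmp \<Lambda> \<mu> \<nu>"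
  shows "\<mu>' = \<mu>" "\<nu>' = \<nu>"
proof -
  note ex1 = factorization_ex1[OF cmp_closed(1)[OF assms(1-3)] arrow_closed(7)[OF assms(1)]
    arrow_closed(7)[OF assms(2)] cmp_closed(4)[OF assms(1-3)]]
  have "(\<mu>', \<nu>') = (\<mu>, \<nu>)"
    by (rule trans[OF the1_equality[OF ex1, symmetric] the1_equality[OF ex1]]) (simp_all add: assms)
  then show "\<mu>' = \<mu>" "\<nu>' = \<nu>" by simp_all
qed

lemma rng_src_in_verts:
  assumes "f \<in> arrows \<Lambda>" shows "rng \<Lambda> f \<in> verts \<Lambda>" "src \<Lambda> f \<in> verts \<Lambda>"
  using arrow_closed[OF assms] by (auto simp: verts_def of_degree_def)

text \<open>Arrows of degree 0 are identities: composing \<open>f\<close> with its source on one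
  side and with its range on the other factorises \<open>f\<close> twice with the same degrees, so
  the factors agree.\<close>

lemma vert_rng_src:
  assumes "f \<in> verts \<Lambda>" shows "rng \<Lambda> f = f" "src \<Lambda> f = f"
proof -
  have f: "f \<in> arrows \<Lambda>" "deg \<Lambda> f = (\<lambda>i. 0)" using assms by (auto simp: verts_def of_degree_def)
  note c = arrow_closed[OF f(1)]
  show "rng \<Lambda> f = f" "src \<Lambda> f = f"
    using factorization_unique[of f "src \<Lambda> f" "rng \<Lambda> f" f] f c by auto
qed

lemma path_count_zero: "v \<in> verts \<Lambda> \<Longrightarrow> path_count \<Lambda> (\<lambda>i. 0) v w = (if v = w then 1 else 0)"
proof -
  assume v: "v \<in> verts \<Lambda>"
  have "{f \<in> of_degree \<Lambda> (\<lambda>i. 0). rng \<Lambda> f = v \<and> src \<Lambda> f = w} = (if v = w then {v} else {})"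
    using vert_rng_src v by (auto simp: verts_def)
  then show ?thesis by (simp add: path_count_def)
qed

context
  assumes fin: "finite_kgraph k \<Lambda>"
begin

lemma finite_verts: "finite (verts \<Lambda>)"
  using fin Nk_zero by (auto simp: finite_kgraph_def verts_def)

text \<open>The factorisation property says that composition is a bijection from composable pairs of
  degrees \<open>m\<close> and \<open>n\<close> onto arrows of degree \<open>m + n\<close>; the
  middle vertex becomes the summation index of a matrix product. As addition of degrees is
  commutative, all path count matrices commute.\<close>

lemma path_count_add:
  assumes m: "m \<in> Nk k" and n: "n \<in> Nk k"
  shows "path_count \<Lambda> (\<lambda>i. m i + n i) v w = (\<Sum>u\<in>verts \<Lambda>. path_count \<Lambda> m v u * path_count \<Lambda> n u w)"
proof -
  define F where "F d v w = {f \<in> of_degree \<Lambda> d. rng \<Lambda> f = v \<and> src \<Lambda> f = w}" for d v w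
  have finF: "finite (F d v w)" if "d \<in> Nk k" for d v w
    using that fin by (auto simp: F_def finite_kgraph_def)
  have "bij_betw (\<lambda>(u, \<mu>, \<nu>). cmp \<Lambda> \<mu> \<nu>) (SIGMA u:verts \<Lambda>. F m v u \<times> F n u w) (F (\<lambda>i. m i + n i) v w)"
    unfolding bij_betw_def
  proof
    show "inj_on (\<lambda>(u, \<mu>, \<nu>). cmp \<Lambda> \<mu> \<nu>) (SIGMA u:verts \<Lambda>. F m v u \<times> F n u w)"
    proof (rule inj_onI)
      fix p p'
      assume p: "p \<in> (SIGMA u:verts \<Lambda>. F m v u \<times> F n u w)" "p' \<in> (SIGMA u:verts \<Lambda>. F m v u \<times> F n u w)"
        and eq: "(\<lambda>(u, \<mu>, \<nu>). cmp \<Lambda> \<mu> \<nu>) p = (\<lambda>(u, \<mu>, \<nu>). cmp \<Lambda> \<mu> \<nu>) p'"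
      obtain u \<mu> \<nu> u' \<mu>' \<nu>' where pp: "p = (u, \<mu>, \<nu>)" "p' = (u', \<mu>', \<nu>')"
        by (cases p, cases p') auto
      have "\<mu> = \<mu>'" "\<nu> = \<nu>'"
        using p eq factorization_unique[of \<mu>' \<nu>' \<mu> \<nu>] by (auto simp: pp F_def of_degree_def)
      then show "p = p'" using p by (auto simp: pp F_def)
    qed
    show "(\<lambda>(u, \<mu>, \<nu>). cmp \<Lambda> \<mu> \<nu>) ` (SIGMA u:verts \<Lambda>. F m v u \<times> F n u w) = F (\<lambda>i. m i + n i) v w"
    proof (intro equalityI subsetI)
      fix f assume "f \<in> (\<lambda>(u, \<mu>, \<nu>). cmp \<Lambda> \<mu> \<nu>) ` (SIGMA u:verts \<Lambda>. F m v u \<times> F n u w)"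
      then show "f \<in> F (\<lambda>i. m i + n i) v w"
        using cmp_closed by (auto simp: F_def of_degree_def)
    next
      fix f assume "f \<in> F (\<lambda>i. m i + n i) v w"
      then have f: "f \<in> arrows \<Lambda>" "deg \<Lambda> f = (\<lambda>i. m i + n i)" "rng \<Lambda> f = v" "src \<Lambda> f = w"
        by (auto simp: F_def of_degree_def)
      from factorization[OF f(1) m n f(2)] obtain \<mu> \<nu> where
        *: "\<mu> \<in> arrows \<Lambda>" "\<nu> \<in> arrows \<Lambda>" "deg \<Lambda> \<mu> = m" "deg \<Lambda> \<nu> = n"
          "src \<Lambda> \<mu> = rng \<Lambda> \<nu>" "f = cmp \<Lambda> \<mu> \<nu>" .
      have "(src \<Lambda> \<mu>, \<mu>, \<nu>) \<in> (SIGMA u:verts \<Lambda>. F m v u \<times> F n u w)"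
        using * f cmp_closed[OF *(1,2,5)] rng_src_in_verts[OF *(1)] by (auto simp: F_def of_degree_def)
      then show "f \<in> (\<lambda>(u, \<mu>, \<nu>). cmp \<Lambda> \<mu> \<nu>) ` (SIGMA u:verts \<Lambda>. F m v u \<times> F n u w)"
        using *(6) by force
    qed
  qed
  then have "card (F (\<lambda>i. m i + n i) v w) = card (SIGMA u:verts \<Lambda>. F m v u \<times> F n u w)"
    by (simp add: bij_betw_same_card)
  also have "\<dots> = (\<Sum>u\<in>verts \<Lambda>. card (F m v u \<times> F n u w))"
    using finF m n finite_verts by (intro card_SigmaI) auto
  finally show ?thesis by (simp add: card_cartesian_product path_count_def F_def)
qed

section \<open>Path counts acting on vectors, and the common eigenvector\<close>

abbreviation count_mv :: "(nat \<Rightarrow> nat) \<Rightarrow> ('m \<Rightarrow> real) \<Rightarrow> 'm \<Rightarrow> real" where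
  "count_mv n \<equiv> mv (verts \<Lambda>) (\<lambda>v w. real (path_count \<Lambda> n v w))"

lemma count_mv_count_mv:
  assumes "m \<in> Nk k" "n \<in> Nk k"
  shows "count_mv m (count_mv n x) v = count_mv (\<lambda>i. m i + n i) x v"
  by (simp add: mv_mv[OF finite_verts] path_count_add[OF assms])

lemma count_mv_zero: "v \<in> verts \<Lambda> \<Longrightarrow> count_mv (\<lambda>i. 0) x v = x v"
  by (simp add: mv_def path_count_zero if_distrib[of real] if_distrib[of "\<lambda>a. a * _"] finite_verts cong: if_cong)

text \<open>Peeling off one unit degree at a time shows that the eigenvalue is a product of the
  \<open>r i\<close> alone, independent of the vector. Treating \<open>x\<close> and
  \<open>y\<close> together records that they share it, which is what uniqueness of the
  Perron--Frobenius vector requires.\<close>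

lemma common_eigenvalue:
  assumes "\<And>i v. i \<in> {1..k} \<Longrightarrow> v \<in> verts \<Lambda> \<Longrightarrow> count_mv (unit_deg i) x v = r i * x v"
    and "\<And>i v. i \<in> {1..k} \<Longrightarrow> v \<in> verts \<Lambda> \<Longrightarrow> count_mv (unit_deg i) y v = r i * y v"
    and "n \<in> Nk k"
  shows "\<exists>c. \<forall>v\<in>verts \<Lambda>. count_mv n x v = c * x v \<and> count_mv n y v = c * y v"
  using assms(3)
proof (induction "sum n {1..k}" arbitrary: n)
  case 0
  then have "n i = 0" for i by (cases "i \<in> {1..k}") (auto simp: Nk_def)
  then have "n = (\<lambda>i. 0)" by auto
  then show ?case by (intro exI[of _ 1]) (simp add: count_mv_zero)
next
  case (Suc s)
  then have "sum n {1..k} \<noteq> 0" by linarith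
  then obtain i where i: "i \<in> {1..k}" "n i \<noteq> 0" by (meson sum.neutral)
  define m where "m = n(i := n i - 1)"
  have n_eq: "n = (\<lambda>j. unit_deg i j + m j)" using i by (auto simp: m_def unit_deg_def)
  have m: "m \<in> Nk k" using Suc.prems i by (auto simp: Nk_def m_def)
  have "sum n {1..k} = sum (unit_deg i) {1..k} + sum m {1..k}"
    by (subst n_eq) (simp add: sum.distrib)
  moreover have "sum (unit_deg i) {1..k} = 1" using i by (simp add: unit_deg_def)
  ultimately obtain c where c: "\<forall>v\<in>verts \<Lambda>. count_mv m x v = c * x v \<and> count_mv m y v = c * y v"
    using Suc.hyps(1)[OF _ m] Suc.hyps(2) by auto
  have step: "count_mv n z v = c * r i * z v"
    if "\<And>v. v \<in> verts \<Lambda> \<Longrightarrow> count_mv m z v = c * z v" "\<And>v. v \<in> verts \<Lambda> \<Longrightarrow> count_mv (unit_deg i) z v = r i * z v"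
      "v \<in> verts \<Lambda>" for z v
  proof -
    have "count_mv n z v = count_mv (unit_deg i) (count_mv m z) v"
      by (subst n_eq) (rule count_mv_count_mv[OF Nk_unit_deg[OF i(1)] m, symmetric])
    also have "\<dots> = count_mv (unit_deg i) (\<lambda>w. c * z w) v" by (rule mv_cong) (rule that(1))
    finally show ?thesis using that(2,3) by (simp add: mv_scale)
  qed
  show ?case
    using step[of x] step[of y] c assms(1,2)[OF i(1)] by (intro exI[of _ "c * r i"]) auto
qed

context
  assumes ne: "arrows \<Lambda> \<noteq> {}" and sc: "strongly_connected \<Lambda>"
begin

lemma verts_nonempty: "verts \<Lambda> \<noteq> {}"
  using ne rng_src_in_verts by auto

text \<open>Being a sum of the commuting matrices of path counts, this positive matrix commutes with
  each vertex matrix.\<close>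

lemma positive_degree_sum:
  "\<exists>D. (\<forall>p\<in>verts \<Lambda> \<times> verts \<Lambda>. D p \<in> Nk k) \<and>
    (\<forall>v\<in>verts \<Lambda>. \<forall>w\<in>verts \<Lambda>. 0 < (\<Sum>p\<in>verts \<Lambda> \<times> verts \<Lambda>. real (path_count \<Lambda> (D p) v w)))"
proof -
  have "\<exists>f\<in>arrows \<Lambda>. rng \<Lambda> f = fst p \<and> src \<Lambda> f = snd p" if "p \<in> verts \<Lambda> \<times> verts \<Lambda>" for p
    using sc that by (auto simp: strongly_connected_def)
  then obtain h where h: "\<And>p. p \<in> verts \<Lambda> \<times> verts \<Lambda> \<Longrightarrow>
      h p \<in> arrows \<Lambda> \<and> rng \<Lambda> (h p) = fst p \<and> src \<Lambda> (h p) = snd p"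
    by metis
  show ?thesis
  \<comment> \<open>For each pair of vertices take the degree of a connecting arrow: the term
    indexed by \<open>(v, w)\<close> already makes the entry at \<open>v\<close>, \<open>w\<close>
    positive.\<close>
  proof (intro exI[of _ "\<lambda>p. deg \<Lambda> (h p)"] conjI ballI)
    show D: "deg \<Lambda> (h p) \<in> Nk k" if "p \<in> verts \<Lambda> \<times> verts \<Lambda>" for p
      using h[OF that] arrow_closed by blast
    fix v w assume vw: "v \<in> verts \<Lambda>" "w \<in> verts \<Lambda>"
    then have p: "(v, w) \<in> verts \<Lambda> \<times> verts \<Lambda>" by simp
    have "h (v, w) \<in> {f \<in> of_degree \<Lambda> (deg \<Lambda> (h (v, w))). rng \<Lambda> f = v \<and> src \<Lambda> f = w}"
      using h[OF p] by (simp add: of_degree_def)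
    moreover have "finite {f \<in> of_degree \<Lambda> (deg \<Lambda> (h (v, w))). rng \<Lambda> f = v \<and> src \<Lambda> f = w}"
      using fin D[OF p] by (simp add: finite_kgraph_def)
    ultimately have "0 < path_count \<Lambda> (deg \<Lambda> (h (v, w))) v w"
      unfolding path_count_def card_gt_0_iff by blast
    then show "0 < (\<Sum>p\<in>verts \<Lambda> \<times> verts \<Lambda>. real (path_count \<Lambda> (deg \<Lambda> (h p)) v w))"
      using p finite_verts by (intro sum_pos2[where i = "(v, w)"]) auto
  qed
qed

text \<open>Let \<open>x0\<close> be a positive eigenvector of the positive sum \<open>?B\<close>.
  Since \<open>?B\<close> commutes with each vertex matrix, the image of \<open>x0\<close> under the
  latter is an eigenvector of \<open>?B\<close> for the same eigenvalue, hence a multiple of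
  \<open>x0\<close>, and the factor is the spectral radius because \<open>x0\<close> is positive.
  Conversely, any competitor \<open>y\<close> has the same eigenvalue as \<open>x\<close> under
  every summand of \<open>?B\<close>, so it is proportional to \<open>x\<close>; the normalisation
  and the zeros off the vertices then make the two functions equal.\<close>

lemma pf_vec_ex1:
  "\<exists>!x. (\<forall>v\<in>verts \<Lambda>. 0 < x v) \<and> (\<forall>v. v \<notin> verts \<Lambda> \<longrightarrow> x v = 0) \<and>
     (\<Sum>v\<in>verts \<Lambda>. x v) = 1 \<and>
     (\<forall>i\<in>{1..k}. \<forall>v\<in>verts \<Lambda>. (\<Sum>w\<in>verts \<Lambda>. real (vmat \<Lambda> i v w) * x w) = rho \<Lambda> i * x v)"
    (is "\<exists>!x. ?P x")
proof -
  let ?V = "verts \<Lambda>"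
  from positive_degree_sum obtain D where DB: "(\<forall>p\<in>?V \<times> ?V. D p \<in> Nk k) \<and>
    (\<forall>v\<in>?V. \<forall>w\<in>?V. 0 < (\<Sum>p\<in>?V \<times> ?V. real (path_count \<Lambda> (D p) v w)))" ..
  note D = conjunct1[OF DB, rule_format] and Bpos = conjunct2[OF DB]
  let ?B = "\<lambda>v w. \<Sum>p\<in>?V \<times> ?V. real (path_count \<Lambda> (D p) v w)"
  have B_sum: "mv ?V ?B x v = (\<Sum>p\<in>?V \<times> ?V. count_mv (D p) x v)" for x v
    unfolding mv_def by (simp only: sum_distrib_right) (rule sum.swap)
  note eig_unique = positive_matrix_eigenvector_unique[OF finite_verts verts_nonempty Bpos]
  obtain x0 b where x0: "\<forall>v\<in>?V. 0 < x0 v" "\<forall>v\<in>?V. mv ?V ?B x0 v = b * x0 v"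
    using positive_matrix_eigenvector[OF finite_verts verts_nonempty Bpos] by blast
  have eig: "count_mv (unit_deg i) x0 v = rho \<Lambda> i * x0 v" if i: "i \<in> {1..k}" and v: "v \<in> ?V" for i v
  proof -
    let ?y = "count_mv (unit_deg i) x0"
    note u = Nk_unit_deg[OF i]
    have "\<forall>v\<in>?V. mv ?V ?B ?y v = b * ?y v"
    proof
      fix v
      have "mv ?V ?B ?y v = (\<Sum>p\<in>?V \<times> ?V. count_mv (unit_deg i) (count_mv (D p) x0) v)"
        unfolding B_sum
        by (intro sum.cong refl) (simp add: count_mv_count_mv[OF u D] count_mv_count_mv[OF D u] add.commute)
      also have "\<dots> = count_mv (unit_deg i) (mv ?V ?B x0) v"
        unfolding B_sum mv_def[of _ "\<lambda>v w. real (path_count \<Lambda> (unit_deg i) v w)"]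
        by (simp only: sum_distrib_left) (rule sum.swap)
      also have "\<dots> = count_mv (unit_deg i) (\<lambda>w. b * x0 w) v" by (rule mv_cong) (use x0(2) in blast)
      finally show "mv ?V ?B ?y v = b * ?y v" by (simp only: mv_scale)
    qed
    from eig_unique[OF x0 this] obtain c where c: "\<forall>v\<in>?V. ?y v = c * x0 v" ..
    have "rho \<Lambda> i = c" unfolding rho_def
      by (rule spectral_radius_on_eqI[OF finite_verts verts_nonempty, of x0]) (use x0(1) c in \<open>simp_all add: vmat_path_count\<close>)
    with c v show ?thesis by simp
  qed
  define s where "s = sum x0 ?V"
  have s: "0 < s" unfolding s_def by (rule sum_pos) (use finite_verts verts_nonempty x0(1) in auto)
  define x where "x = (\<lambda>v. if v \<in> ?V then inverse s * x0 v else 0)"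
  have "count_mv (unit_deg i) x v = inverse s * count_mv (unit_deg i) x0 v" for i v
    by (subst mv_scale[symmetric]) (rule mv_cong, simp add: x_def)
  then have xeig: "count_mv (unit_deg i) x v = rho \<Lambda> i * x v" if "i \<in> {1..k}" "v \<in> ?V" for i v
    using eig[OF that] that by (simp add: x_def)
  have Px: "?P x"
  proof (intro conjI ballI allI impI)
    show "sum x ?V = 1" using s by (simp add: x_def sum_distrib_left[symmetric] s_def[symmetric])
    show "(\<Sum>w\<in>verts \<Lambda>. real (vmat \<Lambda> i v w) * x w) = rho \<Lambda> i * x v"
      if "i \<in> {1..k}" "v \<in> ?V" for i v using xeig[OF that] by (simp add: vmat_path_count mv_def)
  qed (use x0(1) s in \<open>auto simp: x_def\<close>)
  show ?thesis
  proof (rule ex1I[where P = "?P", OF Px])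
    fix y assume Py: "?P y"
    note y_eq = conjunct2[OF conjunct2[OF conjunct2[OF Py]], rule_format]
    have yeig: "count_mv (unit_deg i) y v = rho \<Lambda> i * y v" if "i \<in> {1..k}" "v \<in> ?V" for i v
      using y_eq[OF that] by (simp only: vmat_path_count mv_def)
    have "\<exists>c. \<forall>v\<in>?V. count_mv (D p) x v = c * x v \<and> count_mv (D p) y v = c * y v" if "p \<in> ?V \<times> ?V" for p
      by (rule common_eigenvalue[OF xeig yeig D[OF that]])
    then have "\<forall>p\<in>?V \<times> ?V. \<exists>c. \<forall>v\<in>?V. count_mv (D p) x v = c * x v \<and> count_mv (D p) y v = c * y v" by blast
    from bchoice[OF this] obtain c where
      c: "\<forall>p\<in>?V \<times> ?V. \<forall>v\<in>?V. count_mv (D p) x v = c p * x v \<and> count_mv (D p) y v = c p * y v" ..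
    let ?r = "\<Sum>p\<in>?V \<times> ?V. c p"
    have "\<forall>v\<in>?V. mv ?V ?B x v = ?r * x v" "\<forall>v\<in>?V. mv ?V ?B y v = ?r * y v"
      unfolding B_sum sum_distrib_right
      by (intro ballI sum.cong refl, erule (1) conjunct1[OF c[rule_format]])
        (intro ballI sum.cong refl, erule (1) conjunct2[OF c[rule_format]])
    from eig_unique[OF conjunct1[OF Px] this] obtain e where e: "\<forall>v\<in>?V. y v = e * x v" ..
    have "sum y ?V = e * sum x ?V" using e by (simp add: sum_distrib_left)
    then have "e = 1" using Px Py by simp
    show "y = x"
    proof
      fix v show "y v = x v" using e Px Py \<open>e = 1\<close> by (cases "v \<in> ?V") auto
    qed
  qed
qed

lemma pf_vec_props:
  shows pf_vec_pos: "\<And>v. v \<in> verts \<Lambda> \<Longrightarrow> 0 < pf_vec k \<Lambda> v"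
    and pf_vec_sum: "(\<Sum>v\<in>verts \<Lambda>. pf_vec k \<Lambda> v) = 1"
    and pf_vec_eig: "\<And>i v. i \<in> {1..k} \<Longrightarrow> v \<in> verts \<Lambda> \<Longrightarrow>
      (\<Sum>w\<in>verts \<Lambda>. real (vmat \<Lambda> i v w) * pf_vec k \<Lambda> w) = rho \<Lambda> i * pf_vec k \<Lambda> v"
  using theI'[OF pf_vec_ex1] unfolding pf_vec_def[symmetric] by blast+

end
end
end

section \<open>Paths in the Bratteli diagram\<close>

text \<open>The range is read off the first edge even if \<open>n = 0\<close>, so
  \<open>seg x 0 = seg y 0\<close> says that two paths start at the same vertex, that is, that they
  have a common initial segment at all.\<close>

definition seg :: "(nat \<Rightarrow> 'm edge) \<Rightarrow> nat \<Rightarrow> 'm bpath" where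
  "seg x n = (edge_rng (x 0), map x [0..<n])"

definition trunc :: "nat \<Rightarrow> 'm bpath \<Rightarrow> 'm bpath" where
  "trunc n \<eta> = (fst \<eta>, take n (snd \<eta>))"

definition paths_of_length :: "nat \<Rightarrow> ('m, 'b) kgraph_scheme \<Rightarrow> nat \<Rightarrow> 'm bpath set" where
  "paths_of_length k \<Lambda> n = {\<eta> \<in> fin_paths k \<Lambda>. path_length \<eta> = n}"

text \<open>The product in \<open>weight\<close>, taken edge by edge, so that passing to one more
  edge is a single multiplication.\<close>

definition rho_prod :: "nat \<Rightarrow> ('m, 'b) kgraph_scheme \<Rightarrow> nat \<Rightarrow> real" where
  "rho_prod k \<Lambda> n = (\<Prod>j<n. rho \<Lambda> (colour k (Suc j)))"

definition mass :: "nat \<Rightarrow> ('m, 'b) kgraph_scheme \<Rightarrow> 'm bpath \<Rightarrow> real" where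
  "mass k \<Lambda> \<eta> = pf_vec k \<Lambda> (snd (path_src \<eta>)) / rho_prod k \<Lambda> (path_length \<eta>)"

lemma path_length_seg [simp]: "path_length (seg x n) = n"
  by (simp add: path_length_def seg_def)

lemma trunc_seg: "m \<le> n \<Longrightarrow> trunc m (seg x n) = seg x m"
  by (simp add: trunc_def seg_def take_map)

lemma trunc_trunc: "m \<le> n \<Longrightarrow> trunc m (trunc n \<eta>) = trunc m \<eta>"
  by (simp add: trunc_def min_def)

lemma trunc_self: "path_length \<eta> \<le> n \<Longrightarrow> trunc n \<eta> = \<eta>"
  by (simp add: trunc_def path_length_def)

lemma seg_eq_mono: "seg x n = seg y n \<Longrightarrow> m \<le> n \<Longrightarrow> seg x m = seg y m"
  using trunc_seg[of m n x] trunc_seg[of m n y] by simp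

lemma seg_eq_imp: "seg x n = seg y n \<Longrightarrow> j < n \<Longrightarrow> x j = y j"
  by (auto simp: seg_def)

lemma colour_in: "k \<ge> 1 \<Longrightarrow> colour k n \<in> {1..k}"
  by (simp add: colour_def Suc_leI)

lemma cylinder_iff: "x \<in> cylinder k \<Lambda> \<eta> \<longleftrightarrow> x \<in> inf_paths k \<Lambda> \<and> seg x (path_length \<eta>) = \<eta>"
proof -
  obtain v es where \<eta>: "\<eta> = (v, es)" by (rule prod.exhaust)
  have "map x [0..<length es] = es \<longleftrightarrow> (\<forall>j<length es. x j = es ! j)"
    unfolding list_eq_iff_nth_eq by simp
  then show ?thesis
    unfolding \<eta> cylinder_def seg_def path_length_def by (simp only: fst_conv snd_conv prod.inject) blast
qed

lemma bedge_ends: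
  assumes "e \<in> bedge k \<Lambda> (Suc n)"
  shows "edge_rng e \<in> bvert \<Lambda> n" "edge_src e \<in> bvert \<Lambda> (Suc n)"
  using assms by (auto simp: bedge_def bvert_def)

lemma seg_in_fin_paths:
  assumes "x \<in> inf_paths k \<Lambda>"
  shows "seg x n \<in> fin_paths k \<Lambda>"
proof -
  have x: "x j \<in> bedge k \<Lambda> (Suc j)" "edge_src (x j) = edge_rng (x (Suc j))" for j
    using assms by (simp_all add: inf_paths_def)
  have "hd (map x [0..<n]) = x 0" if "n \<noteq> 0"
    using that by (simp add: hd_map)
  then show ?thesis using x bedge_ends(1)[OF x(1)[of 0]] by (simp add: fin_paths_def seg_def)
qed

lemma path_src_bvert:
  assumes "\<eta> \<in> fin_paths k \<Lambda>"
  shows "path_src \<eta> \<in> bvert \<Lambda> (path_length \<eta>)"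
proof (cases "snd \<eta> = []")
  case True
  then show ?thesis using assms by (simp add: fin_paths_def path_src_def path_length_def case_prod_unfold)
next
  case False
  let ?n = "length (snd \<eta>) - 1"
  have "snd \<eta> ! ?n \<in> bedge k \<Lambda> (Suc ?n)"
  proof -
    have "?n < length (snd \<eta>)" using False by simp
    then show ?thesis using assms unfolding fin_paths_def case_prod_unfold by blast
  qed
  from bedge_ends(2)[OF this] show ?thesis using False
    by (simp add: path_src_def path_length_def last_conv_nth)
qed

lemma path_src_vert:
  assumes "\<eta> \<in> fin_paths k \<Lambda>"
  shows "path_src \<eta> = (path_length \<eta>, snd (path_src \<eta>))" "snd (path_src \<eta>) \<in> verts \<Lambda>"
  using path_src_bvert[OF assms] by (simp_all add: bvert_def mem_Times_iff prod_eq_iff)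

text \<open>One more edge moves the index \<open>t + 1\<close> from the second product to the first.
  When \<open>t + 1 = k\<close> every exponent has reached \<open>q + 1\<close>, and the quotient
  increases while the remainder returns to 0.\<close>

lemma rho_prod_weight:
  assumes "k \<ge> 1"
  shows "(\<Prod>i\<in>{1..n mod k}. rho \<Lambda> i ^ (n div k + 1)) * (\<Prod>i\<in>{n mod k + 1..k}. rho \<Lambda> i ^ (n div k))
    = rho_prod k \<Lambda> n"
proof (induction n)
  case 0
  then show ?case by (simp add: rho_prod_def)
next
  case (Suc n)
  define q t where "q = n div k" and "t = n mod k"
  have t: "t < k" using assms by (simp add: t_def)
  have col: "colour k (Suc n) = Suc t" by (simp add: colour_def t_def)
  have split: "{t + 1..k} = insert (Suc t) {t + 2..k}" using t by auto
  have "rho_prod k \<Lambda> (Suc n) = rho_prod k \<Lambda> n * rho \<Lambda> (Suc t)"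
    by (simp add: rho_prod_def col)
  also have "\<dots> = (\<Prod>i\<in>{1..t}. rho \<Lambda> i ^ (q + 1)) * (rho \<Lambda> (Suc t) ^ q * (\<Prod>i\<in>{t + 2..k}. rho \<Lambda> i ^ q)) * rho \<Lambda> (Suc t)"
    using Suc unfolding q_def[symmetric] t_def[symmetric] split by simp
  also have "\<dots> = (\<Prod>i\<in>{1..Suc t}. rho \<Lambda> i ^ (q + 1)) * (\<Prod>i\<in>{t + 2..k}. rho \<Lambda> i ^ q)"
    by simp
  also have "\<dots> = (\<Prod>i\<in>{1..Suc n mod k}. rho \<Lambda> i ^ (Suc n div k + 1)) *
      (\<Prod>i\<in>{Suc n mod k + 1..k}. rho \<Lambda> i ^ (Suc n div k))"
  proof (cases "Suc t = k")
    case True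
    then have "Suc n mod k = 0" "Suc n div k = q + 1"
      by (simp_all add: t_def q_def mod_Suc div_Suc)
    then show ?thesis using True by simp
  next
    case False
    then have "Suc n mod k = Suc t" "Suc n div k = q"
      by (simp_all add: t_def q_def mod_Suc div_Suc)
    then show ?thesis by simp
  qed
  finally show ?case by simp
qed

lemma weight_eq:
  assumes "k \<ge> 1"
  shows "weight k \<Lambda> \<delta> \<eta> = rho_prod k \<Lambda> (path_length \<eta>) powr (- 1 / \<delta>) * pf_vec k \<Lambda> (snd (path_src \<eta>))"
  by (simp only: weight_def Let_def rho_prod_weight[OF assms])

lemma rho_prod_period: "rho_prod k \<Lambda> (q * k + t) = rho_prod k \<Lambda> k ^ q * rho_prod k \<Lambda> t"
proof (induction q)
  case (Suc q)
  have *: "rho_prod k \<Lambda> (k + n) = rho_prod k \<Lambda> k * rho_prod k \<Lambda> n" for n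
  proof (induction n)
    case (Suc n)
    have "colour k (Suc (k + n)) = colour k (Suc n)" by (simp add: colour_def)
    with Suc show ?case by (simp add: rho_prod_def)
  qed (simp add: rho_prod_def)
  have "Suc q * k + t = k + (q * k + t)" by simp
  then show ?case using Suc by (simp only: *) simp
qed simp

section \<open>Common initial segments and the distance\<close>

lemma common_segmentsI:
  assumes "x \<in> inf_paths k \<Lambda>" "y \<in> inf_paths k \<Lambda>" "seg x n = seg y n"
  shows "seg x n \<in> common_segments k \<Lambda> x y"
  using assms seg_in_fin_paths[OF assms(1), of n] by (simp add: common_segments_def cylinder_iff)

lemma common_segmentsD:
  assumes "\<eta> \<in> common_segments k \<Lambda> x y"
  shows "x \<in> inf_paths k \<Lambda>" "y \<in> inf_paths k \<Lambda>" "\<eta> \<in> fin_paths k \<Lambda>"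
    "seg x (path_length \<eta>) = \<eta>" "seg y (path_length \<eta>) = \<eta>"
  using assms by (simp_all add: common_segments_def cylinder_iff)

text \<open>An index at which the paths differ bounds every length of agreement, so a greatest one
  exists.\<close>

lemma last_common_segment:
  assumes "x \<noteq> y" "seg x m = seg y m"
  obtains N where "m \<le> N" "seg x N = seg y N" "\<And>n. seg x n = seg y n \<Longrightarrow> n \<le> N"
proof -
  obtain j where j: "x j \<noteq> y j" using assms by auto
  have b: "n \<le> j" if "seg x n = seg y n" for n
    using seg_eq_imp[OF that, of j] j by (meson not_le)
  define N where "N = Greatest (\<lambda>n. seg x n = seg y n)"
  have N: "seg x N = seg y N" unfolding N_def
    by (rule GreatestI_nat[where P = "\<lambda>n. seg x n = seg y n" and k = m and b = j]) (use assms b in auto)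
  have le: "n \<le> N" if "seg x n = seg y n" for n unfolding N_def
    by (rule Greatest_le_nat[where P = "\<lambda>n. seg x n = seg y n" and b = j]) (use that b in auto)
  show thesis by (rule that[OF le[OF assms(2)] N le])
qed

lemma path_meet_eq:
  assumes "x \<in> inf_paths k \<Lambda>" "y \<in> inf_paths k \<Lambda>"
    and "seg x N = seg y N" "\<And>n. seg x n = seg y n \<Longrightarrow> n \<le> N"
  shows "path_meet k \<Lambda> x y = seg x N"
  unfolding path_meet_def
proof (rule the_equality)
  have le: "path_length \<zeta> \<le> N" if "\<zeta> \<in> common_segments k \<Lambda> x y" for \<zeta>
    using common_segmentsD(4,5)[OF that] by (intro assms(4)) simp
  show "seg x N \<in> common_segments k \<Lambda> x y \<and>
    (\<forall>\<zeta>\<in>common_segments k \<Lambda> x y. path_length \<zeta> \<le> path_length (seg x N))"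
    using le common_segmentsI[OF assms(1-3)] by simp
  fix \<eta> assume *: "\<eta> \<in> common_segments k \<Lambda> x y \<and>
    (\<forall>\<zeta>\<in>common_segments k \<Lambda> x y. path_length \<zeta> \<le> path_length \<eta>)"
  then have "path_length (seg x N) \<le> path_length \<eta>"
    using common_segmentsI[OF assms(1-3)] by blast
  with le[of \<eta>] * have "path_length \<eta> = N" by simp
  then show "\<eta> = seg x N" using common_segmentsD(4)[of \<eta> k \<Lambda> x y] * by simp
qed

lemma path_dist_eq:
  assumes "x \<in> inf_paths k \<Lambda>" "y \<in> inf_paths k \<Lambda>" "x \<noteq> y" "seg x N = seg y N"
    and "\<And>n. seg x n = seg y n \<Longrightarrow> n \<le> N"
  shows "path_dist k \<Lambda> \<delta> x y = weight k \<Lambda> \<delta> (seg x N)"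
proof -
  have "common_segments k \<Lambda> x y \<noteq> {}" using common_segmentsI[OF assms(1,2,4)] by blast
  then show ?thesis using assms(3) path_meet_eq[OF assms(1,2,4,5)] by (simp add: path_dist_def)
qed

lemma path_dist_disjoint:
  assumes "seg x 0 \<noteq> seg y 0"
  shows "path_dist k \<Lambda> \<delta> x y = 1"
proof -
  have "\<eta> \<notin> common_segments k \<Lambda> x y" for \<eta>
  proof
    assume "\<eta> \<in> common_segments k \<Lambda> x y"
    then have "seg x (path_length \<eta>) = seg y (path_length \<eta>)"
      using common_segmentsD(4,5) by metis
    then show False using seg_eq_mono[of x _ y 0] assms by blast
  qed
  then have "common_segments k \<Lambda> x y = {}" by blast
  moreover have "x \<noteq> y" using assms by blast
  ultimately show ?thesis by (simp add: path_dist_def)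
qed

lemma path_dist_self [simp]: "path_dist k \<Lambda> \<delta> x x = 0"
  by (simp add: path_dist_def)

lemma path_dist_commute: "path_dist k \<Lambda> \<delta> x y = path_dist k \<Lambda> \<delta> y x"
proof -
  have "common_segments k \<Lambda> x y = common_segments k \<Lambda> y x"
    by (auto simp: common_segments_def)
  then show ?thesis by (simp add: path_dist_def path_meet_def eq_commute)
qed

lemma fin_paths_snoc:
  "(v, es @ [e]) \<in> fin_paths k \<Lambda> \<longleftrightarrow>
    (v, es) \<in> fin_paths k \<Lambda> \<and> e \<in> bedge k \<Lambda> (Suc (length es)) \<and> edge_rng e = path_src (v, es)"
proof (cases es rule: rev_cases)
  case Nil
  then show ?thesis by (auto simp: fin_paths_def path_src_def)
next
  case (snoc fs f)
  have edges: "(\<forall>j < length (es @ [e]). (es @ [e]) ! j \<in> bedge k \<Lambda> (Suc j)) \<longleftrightarrow>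
    (\<forall>j < length es. es ! j \<in> bedge k \<Lambda> (Suc j)) \<and> e \<in> bedge k \<Lambda> (Suc (length es))"
    by (auto simp: nth_append less_Suc_eq)
  have links: "(\<forall>j. Suc j < length (es @ [e]) \<longrightarrow> edge_src ((es @ [e]) ! j) = edge_rng ((es @ [e]) ! Suc j)) \<longleftrightarrow>
    (\<forall>j. Suc j < length es \<longrightarrow> edge_src (es ! j) = edge_rng (es ! Suc j)) \<and> edge_src f = edge_rng e"
    (is "?L \<longleftrightarrow> ?R")
  proof
    assume L: ?L
    have "edge_src (es ! j) = edge_rng (es ! Suc j)" if "Suc j < length es" for j
      using L[rule_format, of j] that by (simp add: nth_append)
    moreover have "edge_src f = edge_rng e"
      using L[rule_format, of "length fs"] by (simp add: nth_append snoc)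
    ultimately show ?R by blast
  next
    assume R: ?R
    show ?L
    proof (intro allI impI)
      fix j assume j: "Suc j < length (es @ [e])"
      show "edge_src ((es @ [e]) ! j) = edge_rng ((es @ [e]) ! Suc j)"
      proof (cases "Suc j < length es")
        case True
        then show ?thesis using R by (simp add: nth_append)
      next
        case False
        then have "j = length fs" using j snoc by simp
        then show ?thesis using R by (simp add: nth_append snoc)
      qed
    qed
  qed
  have src: "path_src (v, es) = edge_src f" by (simp add: path_src_def snoc)
  have heads: "(es @ [e] \<noteq> [] \<longrightarrow> edge_rng (hd (es @ [e])) = v) \<longleftrightarrow> edge_rng (hd es) = v"
    "(es \<noteq> [] \<longrightarrow> edge_rng (hd es) = v) \<longleftrightarrow> edge_rng (hd es) = v"
    by (simp_all add: snoc hd_append)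
  show ?thesis
    unfolding fin_paths_def mem_Collect_eq case_prod_conv edges links src heads
    by (intro iffI conjI; elim conjE; (assumption | erule sym))
qed

lemma filterlim_powr_neg_at_right_0:
  fixes a :: real
  assumes "a < 0"
  shows "filterlim (\<lambda>x. x powr a) at_top (at_right 0)"
  using assms by real_asymp

lemma power_powr_swap: "0 < (x::real) \<Longrightarrow> (x ^ q) powr a = (x powr a) ^ q"
  by (induction q) (simp_all add: powr_mult)

section \<open>Mass, metric and Hausdorff measure\<close>

locale diam_kgraph =
  fixes k :: nat and \<Lambda> :: "('m, 'b) kgraph_scheme" and \<delta> :: real
  assumes k_ge_1: "k \<ge> 1"
    and kg: "k_graph k \<Lambda>"
    and arrows_nonempty: "arrows \<Lambda> \<noteq> {}"
    and fin: "finite_kgraph k \<Lambda>"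
    and sc: "strongly_connected \<Lambda>"
    and \<delta>_pos: "0 < \<delta>" and \<delta>_less_1: "\<delta> < 1"
    and diam: "\<And>\<eta>. \<eta> \<in> fin_paths k \<Lambda> \<Longrightarrow>
      ennreal (weight k \<Lambda> \<delta> \<eta>) = Metric_space.mdiam (path_dist k \<Lambda> \<delta>) (cylinder k \<Lambda> \<eta>)"
begin

abbreviation "X \<equiv> inf_paths k \<Lambda>"
abbreviation "FP \<equiv> fin_paths k \<Lambda>"
abbreviation "FPn \<equiv> paths_of_length k \<Lambda>"
abbreviation "cyl \<equiv> cylinder k \<Lambda>"
abbreviation "dist\<^sub>X \<equiv> path_dist k \<Lambda> \<delta>"
abbreviation "wt \<equiv> weight k \<Lambda> \<delta>"
abbreviation "ms \<equiv> mass k \<Lambda>"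
abbreviation "pv \<equiv> pf_vec k \<Lambda>"
abbreviation "rp \<equiv> rho_prod k \<Lambda>"

lemmas pv_pos = pf_vec_pos[OF kg fin arrows_nonempty sc]
  and pv_sum = pf_vec_sum[OF kg fin arrows_nonempty sc]
  and pv_eig = pf_vec_eig[OF kg fin arrows_nonempty sc]
  and V_nonempty = verts_nonempty[OF kg fin arrows_nonempty sc]
  and V_finite = finite_verts[OF kg fin]

section \<open>Weights, diameters and positivity of the spectral radii\<close>

lemma pv_le_1: "v \<in> verts \<Lambda> \<Longrightarrow> pv v \<le> 1"
  using member_le_sum[of v "verts \<Lambda>" pv] pv_pos pv_sum V_finite by (simp add: less_imp_le)

lemma src_pv_pos: "\<eta> \<in> FP \<Longrightarrow> 0 < pv (snd (path_src \<eta>))"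
  and src_pv_le_1: "\<eta> \<in> FP \<Longrightarrow> pv (snd (path_src \<eta>)) \<le> 1"
  using path_src_vert(2) pv_pos pv_le_1 by blast+

lemma weight_nonneg: "\<eta> \<in> FP \<Longrightarrow> 0 \<le> wt \<eta>"
  using src_pv_pos[of \<eta>] by (simp add: weight_eq[OF k_ge_1])

lemma dist_nonneg: "0 \<le> dist\<^sub>X x y"
proof (cases "x = y \<or> common_segments k \<Lambda> x y = {}")
  case True
  then show ?thesis by (auto simp: path_dist_def)
next
  case False
  then obtain \<eta> where \<eta>: "\<eta> \<in> common_segments k \<Lambda> x y" by blast
  note c = common_segmentsD[OF \<eta>]
  have "seg x (path_length \<eta>) = seg y (path_length \<eta>)" using c by simp
  with False obtain N where "seg x N = seg y N" "\<And>n. seg x n = seg y n \<Longrightarrow> n \<le> N"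
    using last_common_segment[of x y] by metis
  then have "dist\<^sub>X x y = wt (seg x N)" using False c by (intro path_dist_eq) auto
  then show ?thesis using weight_nonneg seg_in_fin_paths[OF c(1)] by simp
qed

text \<open>The diameter is only unfolded through some metric space carrying the distance. The empty
  carrier serves before the weights are known to decrease along paths.\<close>

lemma metric_empty: "Metric_space {} dist\<^sub>X"
  by (rule Metric_space.intro) (simp_all add: dist_nonneg path_dist_commute)

lemmas mdiam_eq = Metric_space.mdiam_def[OF metric_empty]

lemma mdiam_mono: "U \<subseteq> W \<Longrightarrow> Metric_space.mdiam dist\<^sub>X U \<le> Metric_space.mdiam dist\<^sub>X W"
  unfolding mdiam_eq by (intro SUP_subset_mono) auto

lemma dist_le_mdiam: "x \<in> U \<Longrightarrow> y \<in> U \<Longrightarrow> ennreal (dist\<^sub>X x y) \<le> Metric_space.mdiam dist\<^sub>X U"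
  unfolding mdiam_eq by (meson SUP_upper SUP_upper2)

lemma weight_antimono:
  assumes "x \<in> X" "m \<le> n"
  shows "wt (seg x n) \<le> wt (seg x m)"
proof -
  have "cyl (seg x n) \<subseteq> cyl (seg x m)"
    using seg_eq_mono assms(2) by (auto simp: cylinder_iff)
  then have "ennreal (wt (seg x n)) \<le> ennreal (wt (seg x m))"
    unfolding diam[OF seg_in_fin_paths[OF assms(1)]] by (rule mdiam_mono)
  then show ?thesis using weight_nonneg[OF seg_in_fin_paths[OF assms(1)]] by simp
qed

text \<open>Otherwise all distances in the cylinder vanish and its diameter is 0; this includes the
  empty cylinder. Hence the lemma also supplies an infinite path extending a given finite one.
  Positivity of the weight is an assumption because it is not yet known for longer paths.\<close>

lemma cylinder_two_points:
  assumes "\<eta> \<in> FP" "0 < wt \<eta>"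
  shows "\<exists>x\<in>cyl \<eta>. \<exists>y\<in>cyl \<eta>. x \<noteq> y"
proof (rule ccontr)
  assume "\<not> ?thesis"
  then have "dist\<^sub>X x y = 0" if "x \<in> cyl \<eta>" "y \<in> cyl \<eta>" for x y using that by force
  then have "Metric_space.mdiam dist\<^sub>X (cyl \<eta>) \<le> 0"
    unfolding mdiam_eq by (intro SUP_least) simp
  then show False using diam[OF assms(1)] assms(2) by simp
qed

lemma vertex_path: "v \<in> verts \<Lambda> \<Longrightarrow> ((0, v), []) \<in> FP"
  by (simp add: fin_paths_def bvert_def)

text \<open>A path of length 0 has an empty product in its weight, so its weight is positive before
  anything is known about the spectral radii. It therefore extends to an infinite path, whose edges
  exhibit nonzero entries in the vertex matrices of all colours that occur; the eigenvalue equation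
  does the rest.\<close>

lemma rho_pos: "0 < rho \<Lambda> (colour k (Suc n))"
proof -
  obtain v where v: "v \<in> verts \<Lambda>" using V_nonempty by blast
  have "0 < wt ((0, v), [])"
    using pv_pos[OF v] by (simp add: weight_eq[OF k_ge_1] rho_prod_def path_length_def path_src_def)
  then obtain x where "x \<in> cyl ((0, v), [])" using cylinder_two_points[OF vertex_path[OF v]] by blast
  then have "x n \<in> bedge k \<Lambda> (Suc n)" by (simp add: cylinder_iff inf_paths_def)
  then obtain p q j where pq: "p \<in> verts \<Lambda>" "q \<in> verts \<Lambda>" "j < vmat \<Lambda> (colour k (Suc n)) p q"
    unfolding bedge_def by blast
  have "0 < real (vmat \<Lambda> (colour k (Suc n)) p q) * pv q" using pq pv_pos by simp
  also have "\<dots> \<le> (\<Sum>w\<in>verts \<Lambda>. real (vmat \<Lambda> (colour k (Suc n)) p w) * pv w)"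
    using pq pv_pos V_finite by (intro member_le_sum) (auto simp: less_imp_le)
  also have "\<dots> = rho \<Lambda> (colour k (Suc n)) * pv p"
    using pq(1) colour_in[OF k_ge_1] by (rule pv_eig[rotated])
  finally show ?thesis using pv_pos[OF pq(1)] by (simp add: zero_less_mult_iff)
qed

lemma rp_pos: "0 < rp n"
  unfolding rho_prod_def by (intro prod_pos ballI rho_pos)

lemma weight_pos: "\<eta> \<in> FP \<Longrightarrow> 0 < wt \<eta>"
  using src_pv_pos[of \<eta>] rp_pos[of "path_length \<eta>"] by (simp add: weight_eq[OF k_ge_1])

lemma mass_pos: "\<eta> \<in> FP \<Longrightarrow> 0 < ms \<eta>"
  using src_pv_pos[of \<eta>] rp_pos by (simp add: mass_def)

section \<open>Paths of fixed length and additivity of the mass\<close>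

lemma FPn_0: "FPn 0 = (\<lambda>v. ((0, v), [])) ` verts \<Lambda>"
  by (auto simp: paths_of_length_def fin_paths_def path_length_def bvert_def)

lemma FPn_SucE:
  assumes "\<zeta> \<in> FPn (Suc n)"
  obtains \<eta> e where "\<eta> \<in> FPn n" "\<zeta> = (fst \<eta>, snd \<eta> @ [e])" "trunc n \<zeta> = \<eta>"
    "e \<in> bedge k \<Lambda> (Suc n)" "edge_rng e = path_src \<eta>"
proof -
  obtain v es where \<zeta>: "\<zeta> = (v, es)" by (rule prod.exhaust)
  have len: "length es = Suc n" and \<zeta>_fin: "(v, es) \<in> FP"
    using assms by (simp_all add: paths_of_length_def path_length_def \<zeta>)
  then obtain fs e where es: "es = fs @ [e]" by (cases es rule: rev_cases) auto
  with len have n: "length fs = n" by simp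
  have "(v, fs) \<in> FP" "e \<in> bedge k \<Lambda> (Suc n)" "edge_rng e = path_src (v, fs)"
    using \<zeta>_fin unfolding es fin_paths_snoc n by blast+
  then show thesis
    by (intro that[of "(v, fs)" e]) (simp_all add: paths_of_length_def path_length_def n \<zeta> es trunc_def)
qed

lemma children_eq:
  assumes "\<eta> \<in> FPn n"
  shows "{\<zeta> \<in> FPn (Suc n). trunc n \<zeta> = \<eta>} =
    (\<lambda>(q, j). (fst \<eta>, snd \<eta> @ [Edge (Suc n) (snd (path_src \<eta>)) q j])) `
      (SIGMA q:verts \<Lambda>. {..<vmat \<Lambda> (colour k (Suc n)) (snd (path_src \<eta>)) q})"
    (is "?C = ?f ` ?S")
proof (intro equalityI subsetI)
  have \<eta>: "\<eta> \<in> FP" "path_length \<eta> = n" "length (snd \<eta>) = n"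
    using assms by (simp_all add: paths_of_length_def path_length_def)
  note ps = path_src_vert[OF \<eta>(1), unfolded \<eta>(2)]
  {
    fix \<zeta> assume \<zeta>: "\<zeta> \<in> ?C"
    then have \<zeta>1: "\<zeta> \<in> FPn (Suc n)" and tr: "trunc n \<zeta> = \<eta>" by simp_all
    obtain e where e: "\<zeta> = (fst \<eta>, snd \<eta> @ [e])" "e \<in> bedge k \<Lambda> (Suc n)" "edge_rng e = path_src \<eta>"
      using FPn_SucE[OF \<zeta>1] tr by metis
    from e(2) obtain p q j where pq: "e = Edge (Suc n) p q j" "q \<in> verts \<Lambda>" "j < vmat \<Lambda> (colour k (Suc n)) p q"
      unfolding bedge_def by blast
    have "p = snd (path_src \<eta>)" using e(3)[symmetric] pq(1) by simp
    with pq e(1) show "\<zeta> \<in> ?f ` ?S" by (intro image_eqI[of _ _ "(q, j)"]) simp_all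
  next
    fix \<zeta> assume "\<zeta> \<in> ?f ` ?S"
    then obtain q j where qj: "q \<in> verts \<Lambda>" "j < vmat \<Lambda> (colour k (Suc n)) (snd (path_src \<eta>)) q"
      and \<zeta>: "\<zeta> = (fst \<eta>, snd \<eta> @ [Edge (Suc n) (snd (path_src \<eta>)) q j])"
      by auto
    have "Edge (Suc n) (snd (path_src \<eta>)) q j \<in> bedge k \<Lambda> (Suc n)"
      using qj ps(2) by (simp add: bedge_def)
    moreover have "edge_rng (Edge (Suc n) (snd (path_src \<eta>)) q j) = path_src \<eta>"
      using ps(1) by (simp add: prod_eq_iff)
    ultimately have "\<zeta> \<in> FP" unfolding \<zeta> fin_paths_snoc using \<eta> by simp
    then show "\<zeta> \<in> ?C" using \<eta>(3)
      by (simp add: \<zeta> paths_of_length_def path_length_def trunc_def)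
  }
qed

lemma finite_children: "\<eta> \<in> FPn n \<Longrightarrow> finite {\<zeta> \<in> FPn (Suc n). trunc n \<zeta> = \<eta>}"
  unfolding children_eq using V_finite by (intro finite_imageI finite_SigmaI) auto

lemma trunc_FPn: "\<zeta> \<in> FPn (Suc n) \<Longrightarrow> trunc n \<zeta> \<in> FPn n"
  by (erule FPn_SucE) simp

lemma finite_FPn: "finite (FPn n)"
proof (induction n)
  case 0
  then show ?case unfolding FPn_0 using V_finite by (rule finite_imageI)
next
  case (Suc n)
  have "FPn (Suc n) \<subseteq> (\<Union>\<eta>\<in>FPn n. {\<zeta> \<in> FPn (Suc n). trunc n \<zeta> = \<eta>})"
    using trunc_FPn by blast
  then show ?case using Suc finite_children by (rule finite_subset[OF _ finite_UN_I])
qed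

lemma mass_children:
  assumes "\<eta> \<in> FPn n"
  shows "(\<Sum>\<zeta> | \<zeta> \<in> FPn (Suc n) \<and> trunc n \<zeta> = \<eta>. ms \<zeta>) = ms \<eta>"
proof -
  have \<eta>: "\<eta> \<in> FP" "path_length \<eta> = n" "length (snd \<eta>) = n"
    using assms by (simp_all add: paths_of_length_def path_length_def)
  let ?p = "snd (path_src \<eta>)" and ?c = "colour k (Suc n)"
  let ?f = "\<lambda>(q, j). (fst \<eta>, snd \<eta> @ [Edge (Suc n) ?p q j])"
  have "(\<Sum>\<zeta> | \<zeta> \<in> FPn (Suc n) \<and> trunc n \<zeta> = \<eta>. ms \<zeta>) =
      (\<Sum>a\<in>(SIGMA q:verts \<Lambda>. {..<vmat \<Lambda> ?c ?p q}). ms (?f a))"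
    unfolding children_eq[OF assms] by (subst sum.reindex) (auto simp: inj_on_def)
  also have "\<dots> = (\<Sum>a\<in>(SIGMA q:verts \<Lambda>. {..<vmat \<Lambda> ?c ?p q}). pv (fst a) / rp (Suc n))"
    using \<eta>(3) by (intro sum.cong refl) (auto simp: mass_def path_src_def path_length_def)
  also have "\<dots> = (\<Sum>q\<in>verts \<Lambda>. \<Sum>j<vmat \<Lambda> ?c ?p q. pv q / rp (Suc n))"
    using V_finite by (subst sum.Sigma) (auto simp: case_prod_unfold)
  also have "\<dots> = (\<Sum>q\<in>verts \<Lambda>. real (vmat \<Lambda> ?c ?p q) * pv q) / rp (Suc n)"
    by (simp add: sum_divide_distrib)
  also have "\<dots> = rho \<Lambda> ?c * pv ?p / rp (Suc n)"
    using pv_eig[OF colour_in[OF k_ge_1] path_src_vert(2)[OF \<eta>(1)]] by simp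
  also have "\<dots> = ms \<eta>"
    using rho_pos[of n] by (simp add: mass_def \<eta>(2) rho_prod_def)
  finally show ?thesis .
qed

lemma mass_extensions:
  assumes "\<eta> \<in> FPn n" "n \<le> m"
  shows "(\<Sum>\<zeta> | \<zeta> \<in> FPn m \<and> trunc n \<zeta> = \<eta>. ms \<zeta>) = ms \<eta>"
  using assms(2)
proof (induction m rule: dec_induct)
  case base
  have "trunc n \<zeta> = \<zeta>" if "\<zeta> \<in> FPn n" for \<zeta>
    using that by (simp add: paths_of_length_def trunc_self)
  then have "{\<zeta>. \<zeta> \<in> FPn n \<and> trunc n \<zeta> = \<eta>} = {\<eta>}" using assms(1) by auto
  then show ?case by simp
next
  case (step m)
  let ?S = "{\<zeta>. \<zeta> \<in> FPn (Suc m) \<and> trunc n \<zeta> = \<eta>}" and ?T = "{\<xi>. \<xi> \<in> FPn m \<and> trunc n \<xi> = \<eta>}"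
  have "sum ms ?S = (\<Sum>\<xi>\<in>?T. sum ms {\<zeta> \<in> ?S. trunc m \<zeta> = \<xi>})"
  proof (rule sum.group[symmetric])
    show "finite ?S" "finite ?T" using finite_FPn by simp_all
    show "trunc m ` ?S \<subseteq> ?T" using trunc_FPn step(1) by (auto simp: trunc_trunc)
  qed
  also have "\<dots> = (\<Sum>\<xi>\<in>?T. ms \<xi>)"
  proof (rule sum.cong[OF refl])
    fix \<xi> assume \<xi>: "\<xi> \<in> ?T"
    have "{\<zeta> \<in> ?S. trunc m \<zeta> = \<xi>} = {\<zeta>. \<zeta> \<in> FPn (Suc m) \<and> trunc m \<zeta> = \<xi>}"
    proof (intro equalityI subsetI)
      fix \<zeta> assume "\<zeta> \<in> {\<zeta>. \<zeta> \<in> FPn (Suc m) \<and> trunc m \<zeta> = \<xi>}"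
      then show "\<zeta> \<in> {\<zeta> \<in> ?S. trunc m \<zeta> = \<xi>}"
        using \<xi> trunc_trunc[OF step(1), of \<zeta>] by simp
    qed simp
    then show "sum ms {\<zeta> \<in> ?S. trunc m \<zeta> = \<xi>} = ms \<xi>" using mass_children \<xi> by simp
  qed
  finally show ?case using step.IH by simp
qed

lemma mass_total: "(\<Sum>\<eta>\<in>FPn n. ms \<eta>) = 1"
proof (induction n)
  case 0
  have "(\<Sum>\<eta>\<in>FPn 0. ms \<eta>) = (\<Sum>v\<in>verts \<Lambda>. pv v)"
    unfolding FPn_0
    by (subst sum.reindex) (auto simp: inj_on_def mass_def path_src_def path_length_def rho_prod_def)
  then show ?case by (simp add: pv_sum)
next
  case (Suc n)
  have "(\<Sum>\<eta>\<in>FPn (Suc n). ms \<eta>) = (\<Sum>\<xi>\<in>FPn n. sum ms {\<zeta> \<in> FPn (Suc n). trunc n \<zeta> = \<xi>})"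
    by (rule sum.group[symmetric]) (auto intro: finite_FPn trunc_FPn)
  also have "\<dots> = 1" using Suc mass_children by simp
  finally show ?case .
qed

lemma seg_in_FPn: "x \<in> X \<Longrightarrow> seg x n \<in> FPn n"
  by (simp add: paths_of_length_def seg_in_fin_paths)

lemma FPnD: "\<eta> \<in> FPn n \<Longrightarrow> \<eta> \<in> FP" "\<eta> \<in> FPn n \<Longrightarrow> path_length \<eta> = n"
  by (simp_all add: paths_of_length_def)

lemma FP_FPn: "\<eta> \<in> FP \<Longrightarrow> \<eta> \<in> FPn (path_length \<eta>)"
  by (simp add: paths_of_length_def)

lemma X_nonempty: "X \<noteq> {}"
proof -
  obtain v where v: "v \<in> verts \<Lambda>" using V_nonempty by blast
  note vp = vertex_path[OF v]
  show ?thesis using cylinder_two_points[OF vp weight_pos[OF vp]] by (auto simp: cylinder_iff)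
qed

section \<open>The ultrametric\<close>

lemma weight_seg_0_le_1: "x \<in> X \<Longrightarrow> wt (seg x 0) \<le> 1"
  using src_pv_le_1[OF seg_in_fin_paths[of x k \<Lambda> 0]] by (simp add: weight_eq[OF k_ge_1] rho_prod_def)

lemma distE:
  assumes "x \<in> X" "y \<in> X" "x \<noteq> y" "seg x 0 = seg y 0"
  obtains N where "seg x N = seg y N" "\<And>n. seg x n = seg y n \<Longrightarrow> n \<le> N"
    "dist\<^sub>X x y = wt (seg x N)"
proof -
  obtain N where N: "seg x N = seg y N" "\<And>n. seg x n = seg y n \<Longrightarrow> n \<le> N"
    by (rule last_common_segment[OF assms(3,4)]) (rule that)
  show thesis by (rule that[OF N path_dist_eq[OF assms(1-3) N]])
qed

text \<open>Paths from different vertices are at distance 1; the ultrametric inequality needs this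
  to be the largest distance.\<close>

lemma dist_le_1:
  assumes "x \<in> X" "y \<in> X"
  shows "dist\<^sub>X x y \<le> 1"
proof (cases "x = y \<or> seg x 0 \<noteq> seg y 0")
  case True
  then show ?thesis using path_dist_disjoint[of x y k \<Lambda> \<delta>] by auto
next
  case False
  then have ne: "x \<noteq> y" "seg x 0 = seg y 0" by simp_all
  obtain N where "dist\<^sub>X x y = wt (seg x N)" by (rule distE[OF assms ne])
  also have "\<dots> \<le> wt (seg x 0)" by (rule weight_antimono[OF assms(1)]) simp
  also have "\<dots> \<le> 1" by (rule weight_seg_0_le_1[OF assms(1)])
  finally show ?thesis .
qed

text \<open>If \<open>x\<close> agrees with \<open>y\<close> up to \<open>a\<close> and
  \<open>y\<close> with \<open>z\<close> up to \<open>b\<close>, then \<open>x\<close> agrees with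
  \<open>z\<close> at least up to the smaller of the two, and longer segments weigh no more.\<close>

lemma dist_ultrametric:
  assumes "x \<in> X" "y \<in> X" "z \<in> X"
  shows "dist\<^sub>X x z \<le> max (dist\<^sub>X x y) (dist\<^sub>X y z)"
proof (cases "x = y \<or> y = z \<or> x = z \<or> seg x 0 \<noteq> seg y 0 \<or> seg y 0 \<noteq> seg z 0")
  case True
  then consider "x = y" | "y = z" | "x = z" | "dist\<^sub>X x y = 1" | "dist\<^sub>X y z = 1"
    using path_dist_disjoint[of x y k \<Lambda> \<delta>] path_dist_disjoint[of y z k \<Lambda> \<delta>] by blast
  then show ?thesis
    using dist_nonneg[of x y] dist_nonneg[of y z] dist_le_1[OF assms(1,3)]
    by cases (simp_all add: le_max_iff_disj)
next
  case False
  then have ne: "x \<noteq> y" "y \<noteq> z" "x \<noteq> z" and s: "seg x 0 = seg y 0" "seg y 0 = seg z 0" "seg x 0 = seg z 0"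
    by simp_all
  obtain a where a: "seg x a = seg y a" "dist\<^sub>X x y = wt (seg x a)"
    by (rule distE[OF assms(1,2) ne(1) s(1)])
  obtain b where b: "seg y b = seg z b" "dist\<^sub>X y z = wt (seg y b)"
    by (rule distE[OF assms(2,3) ne(2) s(2)])
  obtain c where c: "\<And>n. seg x n = seg z n \<Longrightarrow> n \<le> c" "dist\<^sub>X x z = wt (seg x c)"
    by (rule distE[OF assms(1,3) ne(3) s(3)]) (rule that)
  show ?thesis
  proof (cases "a \<le> b")
    case True
    then have "seg x a = seg z a" using a(1) seg_eq_mono[OF b(1)] by simp
    then have "wt (seg x c) \<le> wt (seg x a)" using weight_antimono[OF assms(1)] c(1) by blast
    then show ?thesis unfolding a(2) c(2) by simp
  next
    case False
    then have xb: "seg x b = seg y b" by (intro seg_eq_mono[OF a(1)]) simp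
    then have "wt (seg x c) \<le> wt (seg x b)"
      using b(1) by (intro weight_antimono[OF assms(1)] c(1)) simp
    then show ?thesis unfolding b(2) c(2) xb by simp
  qed
qed

lemma dist_pos:
  assumes "x \<in> X" "y \<in> X" "x \<noteq> y"
  shows "0 < dist\<^sub>X x y"
proof (cases "seg x 0 = seg y 0")
  case True
  obtain N where "dist\<^sub>X x y = wt (seg x N)" by (rule distE[OF assms True])
  then show ?thesis using weight_pos[OF seg_in_fin_paths[OF assms(1)]] by simp
qed (simp add: path_dist_disjoint)

lemma metric_X: "Metric_space X dist\<^sub>X"
proof (rule Metric_space.intro)
  fix x y z assume xyz: "x \<in> X" "y \<in> X" "z \<in> X"
  show "dist\<^sub>X x z \<le> dist\<^sub>X x y + dist\<^sub>X y z"
    using dist_ultrametric[OF xyz] dist_nonneg[of x y] dist_nonneg[of y z] by linarith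
next
  fix x y assume "x \<in> X" "y \<in> X"
  then show "dist\<^sub>X x y = 0 \<longleftrightarrow> x = y" using dist_pos[of x y] by (cases "x = y") simp_all
qed (simp_all add: dist_nonneg path_dist_commute)

section \<open>Growth of the product of the spectral radii\<close>

definition pv_min :: real where "pv_min = Min (pv ` verts \<Lambda>)"

lemma pv_min_pos: "0 < pv_min"
  unfolding pv_min_def using V_finite V_nonempty pv_pos by (subst Min_gr_iff) auto

lemma pv_min_le: "\<eta> \<in> FP \<Longrightarrow> pv_min \<le> pv (snd (path_src \<eta>))"
  unfolding pv_min_def using V_finite by (intro Min_le finite_imageI imageI path_src_vert(2))

lemma mass_extension_le:
  assumes "\<eta> \<in> FP" "\<zeta> \<in> FPn m" "trunc (path_length \<eta>) \<zeta> = \<eta>" "path_length \<eta> \<le> m"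
  shows "ms \<zeta> \<le> ms \<eta>"
proof -
  have "ms \<zeta> \<le> (\<Sum>\<zeta> | \<zeta> \<in> FPn m \<and> trunc (path_length \<eta>) \<zeta> = \<eta>. ms \<zeta>)"
    using assms(2,3) finite_FPn by (intro member_le_sum) (auto intro: less_imp_le mass_pos FPnD)
  also have "\<dots> = ms \<eta>" by (rule mass_extensions[OF FP_FPn[OF assms(1)] assms(4)])
  finally show ?thesis .
qed

text \<open>If the product of the spectral radii were at most \<open>1\<close>, masses would be bounded below. But
  every cylinder has two points, so its mass splits, which is impossible for a path of nearly
  minimal mass.\<close>

lemma rp_k_gt_1: "1 < rp k"
proof (rule ccontr)
  assume "\<not> 1 < rp k"
  then have le1: "rp k \<le> 1" by simp
  \<comment> \<open>As \<open>rp k\<close> is at most 1, the values of \<open>rp\<close> over the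
    first period dominate all later ones.\<close>
  define Q where "Q = Max (rp ` {..<k})"
  have Q: "rp n \<le> Q" for n
  proof -
    have "rp n = rp k ^ (n div k) * rp (n mod k)"
      using rho_prod_period[of k \<Lambda> "n div k" "n mod k"] by simp
    also have "\<dots> \<le> 1 * rp (n mod k)"
      by (intro mult_right_mono power_le_one le1 less_imp_le[OF rp_pos])
    also have "\<dots> \<le> Q"
    proof -
      have "n mod k < k" using k_ge_1 by simp
      then have "rp (n mod k) \<le> Q" unfolding Q_def by (intro Max_ge) auto
      then show ?thesis by simp
    qed
    finally show ?thesis .
  qed
  have Qpos: "0 < Q" using Q[of 0] rp_pos[of 0] by simp
  define c where "c = pv_min / Q"
  have c: "0 < c" using pv_min_pos Qpos by (simp add: c_def)
  have mass_ge: "c \<le> ms \<eta>" if "\<eta> \<in> FP" for \<eta>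
    unfolding c_def mass_def
    using src_pv_pos[OF that] by (intro frac_le pv_min_le[OF that] rp_pos Q) simp
  then have bdd: "bdd_below (ms ` FP)" by (rule bdd_belowI2)
  define I where "I = Inf (ms ` FP)"
  obtain v where v: "v \<in> verts \<Lambda>" using V_nonempty by blast
  have "ms ` FP \<noteq> {}" using vertex_path[OF v] by blast
  moreover have "Inf (ms ` FP) < I + c" using c by (simp add: I_def)
  ultimately have "\<exists>m\<in>ms ` FP. m < I + c" by (rule cInf_lessD)
  then obtain \<eta> where \<eta>: "\<eta> \<in> FP" "ms \<eta> < I + c" by blast
  obtain x y where xy: "x \<in> cyl \<eta>" "y \<in> cyl \<eta>" "x \<noteq> y"
    using cylinder_two_points[OF \<eta>(1) weight_pos[OF \<eta>(1)]] by blast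
  then have X: "x \<in> X" "y \<in> X" and s: "seg x (path_length \<eta>) = \<eta>" "seg y (path_length \<eta>) = \<eta>"
    by (simp_all add: cylinder_iff)
  obtain N where N: "path_length \<eta> \<le> N" "seg x N = seg y N" "\<And>n. seg x n = seg y n \<Longrightarrow> n \<le> N"
    by (rule last_common_segment[OF xy(3) trans[OF s(1) s(2)[symmetric]]]) (rule that)
  \<comment> \<open>At the last common segment the paths split into two children. One has mass at
    least \<open>I\<close>, the other at least \<open>c\<close>, yet together they have at most the
    mass of \<eta>, which is below \<open>I + c\<close>.\<close>
  let ?a = "seg x (Suc N)" and ?b = "seg y (Suc N)"
  have neq: "?a \<noteq> ?b"
  proof
    assume "?a = ?b"
    from N(3)[OF this] show False by simp
  qed
  have "ms ?a + ms ?b = (\<Sum>\<zeta>\<in>{?a, ?b}. ms \<zeta>)" using neq by simp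
  also have "\<dots> \<le> (\<Sum>\<zeta> | \<zeta> \<in> FPn (Suc N) \<and> trunc N \<zeta> = seg x N. ms \<zeta>)"
  proof (rule sum_mono2)
    show "finite {\<zeta>. \<zeta> \<in> FPn (Suc N) \<and> trunc N \<zeta> = seg x N}" using finite_FPn by simp
    show "{?a, ?b} \<subseteq> {\<zeta>. \<zeta> \<in> FPn (Suc N) \<and> trunc N \<zeta> = seg x N}"
      using X N(2) by (simp add: seg_in_FPn trunc_seg)
    show "0 \<le> ms \<zeta>" if "\<zeta> \<in> {\<zeta>. \<zeta> \<in> FPn (Suc N) \<and> trunc N \<zeta> = seg x N} - {?a, ?b}" for \<zeta>
      using that by (intro less_imp_le[OF mass_pos[OF FPnD(1)]]) blast
  qed
  also have "\<dots> = ms (seg x N)" by (rule mass_children[OF seg_in_FPn[OF X(1)]])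
  also have "\<dots> \<le> ms \<eta>"
    using N(1) s by (intro mass_extension_le[OF \<eta>(1) seg_in_FPn[OF X(1)]]) (simp_all add: trunc_seg)
  finally have "ms ?a + ms ?b < I + c" using \<eta>(2) by simp
  moreover have "I \<le> ms ?a" unfolding I_def
    using bdd seg_in_fin_paths[OF X(1)] by (intro cInf_lower) auto
  moreover have "c \<le> ms ?b" by (rule mass_ge[OF seg_in_fin_paths[OF X(2)]])
  ultimately show False by simp
qed

lemma rp_mult: "rp (q * k) = rp k ^ q"
  using rho_prod_period[of k \<Lambda> q 0] by (simp add: rho_prod_def)

text \<open>Along multiples of \<open>k\<close> the mass is at most the reciprocal of a power of
  \<open>rp k\<close>. This disposes of one-point members of a cover.\<close>

lemma mass_seg_small:
  assumes "x \<in> X" "0 < \<kappa>"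
  shows "\<exists>n. ms (seg x n) < \<kappa>"
proof -
  obtain q where q: "1 / \<kappa> < rp k ^ q" using real_arch_pow[OF rp_k_gt_1] by blast
  have "ms (seg x (q * k)) \<le> 1 / rp k ^ q"
    unfolding mass_def path_length_seg rp_mult
    using src_pv_le_1[OF seg_in_fin_paths[OF assms(1)]] rp_pos
    by (intro divide_right_mono) (auto intro: less_imp_le)
  also have "\<dots> < \<kappa>" using q assms(2) rp_pos[of k] by (simp add: field_simps)
  finally show ?thesis by blast
qed

section \<open>Comparison of mass and weight\<close>

lemma weight_powr_\<delta>:
  assumes "\<eta> \<in> FP"
  shows "wt \<eta> powr \<delta> = pv (snd (path_src \<eta>)) powr \<delta> / rp (path_length \<eta>)"
proof -
  \<comment> \<open>Here \<delta> turns into the dimension: raising to the power \<delta> cancels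
    the exponent of the product, so that the result differs from the mass only in the eigenvector
    entry.\<close>
  have "(rp (path_length \<eta>) powr (- 1 / \<delta>)) powr \<delta> = rp (path_length \<eta>) powr (- 1)"
    unfolding powr_powr using \<delta>_pos by simp
  also have "\<dots> = 1 / rp (path_length \<eta>)"
    using rp_pos[of "path_length \<eta>"] by (simp add: powr_minus_divide)
  finally show ?thesis
    unfolding weight_eq[OF k_ge_1] using src_pv_pos[OF assms] by (subst powr_mult) simp_all
qed

text \<open>Entries of the eigenvector lie in (0, 1] and \<delta> is below 1, so raising them to the
  power \<delta> does not decrease them.\<close>

lemma mass_le_weight:
  assumes "\<eta> \<in> FP"
  shows "ms \<eta> \<le> wt \<eta> powr \<delta>"
proof -
  have "pv (snd (path_src \<eta>)) powr 1 \<le> pv (snd (path_src \<eta>)) powr \<delta>"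
    using src_pv_pos[OF assms] src_pv_le_1[OF assms] \<delta>_less_1 by (intro powr_mono') auto
  then show ?thesis
    unfolding weight_powr_\<delta>[OF assms] mass_def
    using src_pv_pos[OF assms] rp_pos by (intro divide_right_mono) (auto intro: less_imp_le)
qed

text \<open>The constant is the maximum over all vertices of the ratio of the two eigenvector terms:
  the exponent \<delta> - 1 is negative, so the smallest entry is the worst.\<close>

lemma weight_le_mass:
  assumes "\<eta> \<in> FP"
  shows "wt \<eta> powr \<delta> \<le> pv_min powr (\<delta> - 1) * ms \<eta>"
proof -
  let ?x = "pv (snd (path_src \<eta>))"
  have "?x powr \<delta> = ?x powr (\<delta> - 1) * ?x"
    using src_pv_pos[OF assms] by (simp add: powr_diff)
  also have "\<dots> \<le> pv_min powr (\<delta> - 1) * ?x"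
    using src_pv_pos[OF assms] pv_min_le[OF assms] pv_min_pos \<delta>_less_1
    by (intro mult_right_mono powr_mono2') auto
  finally show ?thesis
    unfolding weight_powr_\<delta>[OF assms] mass_def
    using rp_pos by (simp add: divide_right_mono less_imp_le)
qed

text \<open>Double counting at a common length \<open>L\<close>: every path of length
  \<open>L\<close> extends some \<open>\<zeta> i\<close>, and the extensions of
  \<open>\<zeta> i\<close> have total mass \<open>ms (\<zeta> i)\<close>. Overlaps only
  help.\<close>

lemma cover_mass:
  assumes F: "finite F" and \<zeta>: "\<And>i. i \<in> F \<Longrightarrow> \<zeta> i \<in> FP" and cover: "X \<subseteq> (\<Union>i\<in>F. cyl (\<zeta> i))"
  shows "1 \<le> (\<Sum>i\<in>F. ms (\<zeta> i))"
proof -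
  define L where "L = (\<Sum>i\<in>F. path_length (\<zeta> i))"
  have len: "path_length (\<zeta> i) \<le> L" if "i \<in> F" for i
    unfolding L_def using that F by (intro member_le_sum) auto
  have "1 = (\<Sum>\<xi>\<in>FPn L. ms \<xi>)" by (simp add: mass_total)
  also have "\<dots> \<le> (\<Sum>\<xi>\<in>FPn L. \<Sum>i\<in>F. if trunc (path_length (\<zeta> i)) \<xi> = \<zeta> i then ms \<xi> else 0)"
  proof (rule sum_mono)
    fix \<xi> assume \<xi>: "\<xi> \<in> FPn L"
    note \<xi>F = FPnD(1)[OF \<xi>]
    \<comment> \<open>The cover concerns infinite paths, so \<xi> is first extended to one.\<close>
    obtain x where x: "x \<in> X" "seg x L = \<xi>"
      using cylinder_two_points[OF \<xi>F weight_pos[OF \<xi>F]] FPnD(2)[OF \<xi>] by (auto simp: cylinder_iff)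
    obtain i where i: "i \<in> F" "x \<in> cyl (\<zeta> i)" using cover x(1) by blast
    then have "trunc (path_length (\<zeta> i)) \<xi> = \<zeta> i"
      using len[OF i(1)] by (simp add: x(2)[symmetric] trunc_seg cylinder_iff)
    then have "ms \<xi> = (if trunc (path_length (\<zeta> i)) \<xi> = \<zeta> i then ms \<xi> else 0)" by simp
    also have "\<dots> \<le> (\<Sum>i\<in>F. if trunc (path_length (\<zeta> i)) \<xi> = \<zeta> i then ms \<xi> else 0)"
      using F i(1) mass_pos[OF \<xi>F]
      by (intro member_le_sum[where f = "\<lambda>i. if trunc (path_length (\<zeta> i)) \<xi> = \<zeta> i then ms \<xi> else 0"]) auto
    finally show "ms \<xi> \<le> (\<Sum>i\<in>F. if trunc (path_length (\<zeta> i)) \<xi> = \<zeta> i then ms \<xi> else 0)" .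
  qed
  also have "\<dots> = (\<Sum>i\<in>F. \<Sum>\<xi>\<in>FPn L. if trunc (path_length (\<zeta> i)) \<xi> = \<zeta> i then ms \<xi> else 0)"
    by (rule sum.swap)
  also have "\<dots> = (\<Sum>i\<in>F. ms (\<zeta> i))"
  proof (rule sum.cong[OF refl])
    fix i assume i: "i \<in> F"
    have "(\<Sum>\<xi>\<in>FPn L. if trunc (path_length (\<zeta> i)) \<xi> = \<zeta> i then ms \<xi> else 0) =
        (\<Sum>\<xi> | \<xi> \<in> FPn L \<and> trunc (path_length (\<zeta> i)) \<xi> = \<zeta> i. ms \<xi>)"
      by (rule sum.inter_filter[OF finite_FPn, symmetric])
    also have "\<dots> = ms (\<zeta> i)" by (rule mass_extensions[OF FP_FPn[OF \<zeta>[OF i]] len[OF i]])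
    finally show "(\<Sum>\<xi>\<in>FPn L. if trunc (path_length (\<zeta> i)) \<xi> = \<zeta> i then ms \<xi> else 0) = ms (\<zeta> i)" .
  qed
  finally show ?thesis .
qed

section \<open>Hausdorff sums, bounded from above and from below\<close>

lemmas hausdorff_pre_eq = Metric_space.hausdorff_pre_def[OF metric_X]
  and mdiam_powr_eq = Metric_space.mdiam_powr_def[OF metric_X]

lemma mdiam_powr_cylinder:
  assumes "\<eta> \<in> FP" "t \<noteq> 0"
  shows "Metric_space.mdiam_powr dist\<^sub>X (cyl \<eta>) t = ennreal (wt \<eta> powr t)"
  using assms weight_nonneg by (simp add: mdiam_powr_eq diam[symmetric])

lemma hausdorff_pre_le:
  assumes t: "\<delta> < t" and small: "(rp k powr (- 1 / \<delta>)) ^ q < \<epsilon>"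
  shows "Metric_space.hausdorff_pre dist\<^sub>X t \<epsilon> X \<le>
    ennreal (((rp k powr (- 1 / \<delta>)) ^ q) powr (t - \<delta>) * pv_min powr (\<delta> - 1))"
proof -
  \<comment> \<open>At length \<open>q * k\<close> the product in the weight is exactly
    \<open>rp k ^ q\<close>, and eigenvector entries are at most 1, so \<open>b\<close> bounds all
    weights at this level.\<close>
  define b where "b = (rp k powr (- 1 / \<delta>)) ^ q"
  have b0: "0 \<le> b" by (simp add: b_def)
  have wb: "wt \<eta> \<le> b" if "\<eta> \<in> FPn (q * k)" for \<eta>
  proof -
    have "wt \<eta> = b * pv (snd (path_src \<eta>))"
      unfolding weight_eq[OF k_ge_1] FPnD(2)[OF that] rp_mult b_def power_powr_swap[OF rp_pos] by (rule refl)
    then show ?thesis using src_pv_le_1[OF FPnD(1)[OF that]] b0 by (simp add: mult_left_le)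
  qed
  \<comment> \<open>Covers are indexed by natural numbers, so the paths are enumerated.\<close>
  obtain h where h: "bij_betw h {0..<card (FPn (q * k))} (FPn (q * k))"
    using ex_bij_betw_nat_finite[OF finite_FPn] by blast
  let ?F = "{0..<card (FPn (q * k))}"
  have hF: "h i \<in> FPn (q * k)" if "i \<in> ?F" for i using h that by (rule bij_betwE[rule_format])
  have "(\<Union>i\<in>?F. cyl (h i)) = (\<Union>\<eta>\<in>FPn (q * k). cyl \<eta>)"
    using bij_betw_imp_surj_on[OF h] by (metis image_image)
  also have "\<dots> = X"
  proof (intro equalityI subsetI)
    fix x assume "x \<in> X"
    then show "x \<in> (\<Union>\<eta>\<in>FPn (q * k). cyl \<eta>)"
      using seg_in_FPn[of x "q * k"] by (intro UN_I[of "seg x (q * k)"]) (simp_all add: cylinder_iff)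
  qed (auto simp: cylinder_iff)
  finally have cover: "(\<Union>i\<in>?F. cyl (h i)) = X" .
  have "Metric_space.mdiam dist\<^sub>X (cyl (h i)) < ennreal \<epsilon>" if "i \<in> ?F" for i
    using wb[OF hF[OF that]] small FPnD(1)[OF hF[OF that]] weight_nonneg
    by (simp add: diam[symmetric] ennreal_less_iff b_def)
  with cover have "Metric_space.hausdorff_pre dist\<^sub>X t \<epsilon> X \<le>
      (\<Sum>i\<in>?F. Metric_space.mdiam_powr dist\<^sub>X (cyl (h i)) t)"
    unfolding hausdorff_pre_eq by (intro Inf_lower CollectI exI[of _ ?F] exI[of _ "\<lambda>i. cyl (h i)"]) simp
  also have "\<dots> = (\<Sum>\<eta>\<in>FPn (q * k). Metric_space.mdiam_powr dist\<^sub>X (cyl \<eta>) t)"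
    by (rule sum.reindex_bij_betw[OF h])
  also have "\<dots> = (\<Sum>\<eta>\<in>FPn (q * k). ennreal (wt \<eta> powr t))"
    using t \<delta>_pos by (intro sum.cong refl mdiam_powr_cylinder FPnD(1)) auto
  also have "\<dots> = ennreal (\<Sum>\<eta>\<in>FPn (q * k). wt \<eta> powr t)" by simp
  also have "\<dots> \<le> ennreal (\<Sum>\<eta>\<in>FPn (q * k). b powr (t - \<delta>) * (pv_min powr (\<delta> - 1) * ms \<eta>))"
  proof (intro ennreal_leI sum_mono)
    fix \<eta> assume \<eta>: "\<eta> \<in> FPn (q * k)"
    note \<eta>F = FPnD(1)[OF \<eta>]
    \<comment> \<open>The factor with the positive exponent \<open>t - \<delta>\<close> is uniformly
      small; the other one is comparable to the mass, whose sum over a level is 1.\<close>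
    have "wt \<eta> powr t = wt \<eta> powr (t - \<delta>) * wt \<eta> powr \<delta>"
      by (simp add: powr_add[symmetric])
    also have "\<dots> \<le> b powr (t - \<delta>) * (pv_min powr (\<delta> - 1) * ms \<eta>)"
      using t weight_nonneg[OF \<eta>F] wb[OF \<eta>] weight_le_mass[OF \<eta>F]
      by (intro mult_mono powr_mono2) auto
    finally show "wt \<eta> powr t \<le> b powr (t - \<delta>) * (pv_min powr (\<delta> - 1) * ms \<eta>)" .
  qed
  also have "(\<Sum>\<eta>\<in>FPn (q * k). b powr (t - \<delta>) * (pv_min powr (\<delta> - 1) * ms \<eta>)) =
      b powr (t - \<delta>) * pv_min powr (\<delta> - 1)"
    by (simp add: sum_distrib_left[symmetric] mass_total)
  finally show ?thesis unfolding b_def .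
qed

text \<open>Already the infimum at a fixed \<epsilon> vanishes: \<open>q\<close> may grow while
  \<epsilon> stays put, the cylinders remain admissible, and their weights decay geometrically
  because \<open>rp k\<close> exceeds 1.\<close>

lemma hausdorff_pre_zero:
  assumes t: "\<delta> < t" and \<epsilon>: "0 < \<epsilon>"
  shows "Metric_space.hausdorff_pre dist\<^sub>X t \<epsilon> X = 0"
proof -
  define r where "r = rp k powr (- 1 / \<delta>)"
  have "r < 1" unfolding r_def
    using rp_k_gt_1 \<delta>_pos powr_less_mono[of "- 1 / \<delta>" 0 "rp k"] by simp
  moreover have "0 \<le> r" by (simp add: r_def)
  ultimately have lim: "(\<lambda>q. r ^ q) \<longlonglongrightarrow> 0" by (simp add: LIMSEQ_realpow_zero)
  have "(\<lambda>q. (r ^ q) powr (t - \<delta>)) \<longlonglongrightarrow> 0"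
    using t \<open>0 \<le> r\<close> by (intro tendsto_zero_powrI[OF lim tendsto_const]) auto
  then have "(\<lambda>q. ennreal ((r ^ q) powr (t - \<delta>) * pv_min powr (\<delta> - 1))) \<longlonglongrightarrow> ennreal (0 * pv_min powr (\<delta> - 1))"
    by (intro tendsto_ennrealI tendsto_mult tendsto_const)
  moreover have "\<forall>\<^sub>F q in sequentially. Metric_space.hausdorff_pre dist\<^sub>X t \<epsilon> X \<le>
      ennreal ((r ^ q) powr (t - \<delta>) * pv_min powr (\<delta> - 1))"
  proof (rule eventually_mono[OF order_tendstoD(2)[OF lim \<epsilon>]])
    fix q assume "r ^ q < \<epsilon>"
    then show "Metric_space.hausdorff_pre dist\<^sub>X t \<epsilon> X \<le>
      ennreal ((r ^ q) powr (t - \<delta>) * pv_min powr (\<delta> - 1))"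
      unfolding r_def by (rule hausdorff_pre_le[OF t])
  qed
  ultimately have "Metric_space.hausdorff_pre dist\<^sub>X t \<epsilon> X \<le> ennreal (0 * pv_min powr (\<delta> - 1))"
    by (rule tendsto_lowerbound) simp
  then show ?thesis by simp
qed

text \<open>The local inequality of the mass distribution argument. Fix a point \<open>x\<close> of
  \<open>U\<close>. The longest segment of \<open>x\<close> shared by all of \<open>U\<close> is the
  exact meet of \<open>x\<close> with some \<open>y\<close> in \<open>U\<close>, so its weight is a
  distance attained in \<open>U\<close> and bounds the diameter from below. The term \<kappa> serves
  sets with at most one point, whose diameter does not control the mass of a cylinder around
  them.\<close>

lemma small_set_in_cylinder:
  assumes U: "U \<subseteq> X" "Metric_space.mdiam dist\<^sub>X U < ennreal \<epsilon>" and \<epsilon>: "0 < \<epsilon>" "\<epsilon> \<le> 1"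
    and t: "0 \<le> t" "t < \<delta>" and \<kappa>: "0 < \<kappa>"
  shows "\<exists>\<zeta>\<in>FP. U \<subseteq> cyl \<zeta> \<and>
    ennreal (\<epsilon> powr (t - \<delta>) * ms \<zeta>) \<le> Metric_space.mdiam_powr dist\<^sub>X U t + ennreal \<kappa>"
proof (cases "\<exists>x\<in>U. \<exists>y\<in>U. x \<noteq> y")
  case True
  then obtain x z where x: "x \<in> U" and z: "z \<in> U" "x \<noteq> z" by blast
  have xX: "x \<in> X" using x U by blast
  have dist_less: "dist\<^sub>X x y < \<epsilon>" if "y \<in> U" for y
    using le_less_trans[OF dist_le_mdiam[OF x that] U(2)] dist_nonneg by (simp add: ennreal_less_iff)
  \<comment> \<open>Because \<epsilon> is at most 1, no two points of \<open>U\<close> are at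
    distance 1 from each other, so all of \<open>U\<close> starts at one vertex.\<close>
  have seg0: "seg x 0 = seg y 0" if "y \<in> U" for y
    using dist_less[OF that] \<epsilon>(2) path_dist_disjoint[of x y k \<Lambda> \<delta>] by force
  define P where "P n \<longleftrightarrow> (\<exists>y\<in>U. seg x n \<noteq> seg y n)" for n
  obtain j where j: "x j \<noteq> z j" using z(2) by blast
  then have "P (Suc j)" unfolding P_def using z(1) seg_eq_imp[of x "Suc j" z j] by blast
  define n where "n = (LEAST n. P n)"
  have n: "P n" unfolding n_def by (rule LeastI) fact
  have not_P: "\<not> P m" if "m < n" for m using not_less_Least that unfolding n_def by blast
  have "n \<noteq> 0" using n seg0 unfolding P_def by (metis)
  then obtain N where N: "n = Suc N" by (metis not0_implies_Suc)
  obtain y where y: "y \<in> U" "seg x (Suc N) \<noteq> seg y (Suc N)" using n unfolding P_def N by blast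
  have same: "seg x N = seg u N" if "u \<in> U" for u
    using not_P[of N] that unfolding P_def N by blast
  let ?\<zeta> = "seg x N"
  have \<zeta>: "?\<zeta> \<in> FP" by (rule seg_in_fin_paths[OF xX])
  have "m \<le> N" if "seg x m = seg y m" for m
    using seg_eq_mono[OF that, of "Suc N"] y(2) by (meson not_less_eq_eq)
  then have dist: "dist\<^sub>X x y = wt ?\<zeta>"
    using y U(1) same[OF y(1)] by (intro path_dist_eq xX) auto
  have w0: "0 < wt ?\<zeta>" by (rule weight_pos[OF \<zeta>])
  have w\<epsilon>: "wt ?\<zeta> < \<epsilon>" using dist_less[OF y(1)] dist by simp
  \<comment> \<open>The case \<open>t = 0\<close> is separate because \<open>mdiam_powr\<close> is
    then 1 by convention.\<close>
  have "ennreal (wt ?\<zeta> powr t) \<le> Metric_space.mdiam_powr dist\<^sub>X U t"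
  proof (cases "t = 0")
    case True
    then show ?thesis using w0 by (simp add: mdiam_powr_eq)
  next
    case False
    have fin: "Metric_space.mdiam dist\<^sub>X U < \<infinity>" using U(2) by (rule less_trans) (simp add: infinity_ennreal_def)
    have "enn2real (ennreal (wt ?\<zeta>)) \<le> enn2real (Metric_space.mdiam dist\<^sub>X U)"
      using dist_le_mdiam[OF x y(1)] fin unfolding dist infinity_ennreal_def by (rule enn2real_mono)
    then have "wt ?\<zeta> \<le> enn2real (Metric_space.mdiam dist\<^sub>X U)" using w0 by simp
    then show ?thesis using False t(1) w0 by (simp add: mdiam_powr_eq ennreal_leI powr_mono2)
  qed
  \<comment> \<open>The exponent \<open>t - \<delta>\<close> is negative and the weight is below
    \<epsilon>, so replacing \<epsilon> by the weight increases the factor.\<close>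
  moreover have "\<epsilon> powr (t - \<delta>) * ms ?\<zeta> \<le> wt ?\<zeta> powr (t - \<delta>) * wt ?\<zeta> powr \<delta>"
    using mass_le_weight[OF \<zeta>] mass_pos[OF \<zeta>] w0 w\<epsilon> t(2)
    by (intro mult_mono powr_mono2') auto
  moreover have "wt ?\<zeta> powr (t - \<delta>) * wt ?\<zeta> powr \<delta> = wt ?\<zeta> powr t"
    by (simp add: powr_add[symmetric])
  ultimately have "ennreal (\<epsilon> powr (t - \<delta>) * ms ?\<zeta>) \<le> Metric_space.mdiam_powr dist\<^sub>X U t"
    by (metis ennreal_leI order_trans)
  then have "ennreal (\<epsilon> powr (t - \<delta>) * ms ?\<zeta>) \<le> Metric_space.mdiam_powr dist\<^sub>X U t + ennreal \<kappa>"
    by (rule order_trans) simp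
  moreover have "U \<subseteq> cyl ?\<zeta>" using same U(1) by (auto simp: cylinder_iff)
  ultimately show ?thesis using \<zeta> by blast
next
  case False
  \<comment> \<open>For empty \<open>U\<close> any point of \<open>X\<close> will do.\<close>
  obtain x where x: "x \<in> X" "U \<subseteq> {x}"
  proof (cases "U = {}")
    case True
    then show thesis using X_nonempty that by blast
  next
    case nonempty: False
    then obtain x where "x \<in> U" by blast
    then show thesis using False U(1) by (intro that[of x]) blast+
  qed
  have p: "0 < \<epsilon> powr (t - \<delta>)" using \<epsilon>(1) by simp
  obtain n where n: "ms (seg x n) < \<kappa> / \<epsilon> powr (t - \<delta>)"
    using mass_seg_small[OF x(1)] \<kappa> p by (meson divide_pos_pos)
  then have "\<epsilon> powr (t - \<delta>) * ms (seg x n) \<le> \<kappa>" using p by (simp add: field_simps)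
  then have "ennreal (\<epsilon> powr (t - \<delta>) * ms (seg x n)) \<le> ennreal \<kappa>" by (rule ennreal_leI)
  then have "ennreal (\<epsilon> powr (t - \<delta>) * ms (seg x n)) \<le> Metric_space.mdiam_powr dist\<^sub>X U t + ennreal \<kappa>"
    by (rule order_trans) simp
  moreover have "U \<subseteq> cyl (seg x n)" using x by (auto simp: cylinder_iff)
  ultimately show ?thesis using seg_in_fin_paths[OF x(1)] by blast
qed

text \<open>Enlarging each member of a cover to its cylinder gives a cover by cylinders, whose
  masses sum to at least 1. The resulting bound tends to infinity with decreasing \<epsilon>, since
  \<open>t\<close> is below \<delta>.\<close>

lemma hausdorff_pre_ge:
  assumes \<epsilon>: "0 < \<epsilon>" "\<epsilon> \<le> 1" and t: "0 \<le> t" "t < \<delta>"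
  shows "ennreal (\<epsilon> powr (t - \<delta>)) \<le> Metric_space.hausdorff_pre dist\<^sub>X t \<epsilon> X"
  unfolding hausdorff_pre_eq
proof (rule Inf_greatest)
  fix s
  assume "s \<in> {\<Sum>i\<in>F. Metric_space.mdiam_powr dist\<^sub>X (U i) t |(F :: nat set) U.
    finite F \<and> (\<Union>i\<in>F. U i) = X \<and> (\<forall>i\<in>F. Metric_space.mdiam dist\<^sub>X (U i) < ennreal \<epsilon>)}"
  then obtain F :: "nat set" and U where s: "s = (\<Sum>i\<in>F. Metric_space.mdiam_powr dist\<^sub>X (U i) t)"
    and F: "finite F" "(\<Union>i\<in>F. U i) = X" "\<forall>i\<in>F. Metric_space.mdiam dist\<^sub>X (U i) < ennreal \<epsilon>"
    by blast
  show "ennreal (\<epsilon> powr (t - \<delta>)) \<le> s"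
  proof (rule ennreal_le_epsilon)
    fix e :: real assume e: "0 < e"
    \<comment> \<open>The error \<open>e\<close> is shared among the members of the cover; the added
      1 keeps the denominator positive for every \<open>F\<close>.\<close>
    define \<kappa> where "\<kappa> = e / (card F + 1)"
    have \<kappa>: "0 < \<kappa>" using e by (simp add: \<kappa>_def)
    have "\<forall>i\<in>F. \<exists>\<zeta>. \<zeta> \<in> FP \<and> U i \<subseteq> cyl \<zeta> \<and>
      ennreal (\<epsilon> powr (t - \<delta>) * ms \<zeta>) \<le> Metric_space.mdiam_powr dist\<^sub>X (U i) t + ennreal \<kappa>"
    proof
      fix i assume i: "i \<in> F"
      have "U i \<subseteq> X" using F(2) i by blast
      from small_set_in_cylinder[OF this bspec[OF F(3) i] \<epsilon> t \<kappa>]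
      show "\<exists>\<zeta>. \<zeta> \<in> FP \<and> U i \<subseteq> cyl \<zeta> \<and>
        ennreal (\<epsilon> powr (t - \<delta>) * ms \<zeta>) \<le> Metric_space.mdiam_powr dist\<^sub>X (U i) t + ennreal \<kappa>"
        unfolding Bex_def .
    qed
    from bchoice[OF this] obtain \<zeta> where \<zeta>: "\<forall>i\<in>F. \<zeta> i \<in> FP \<and> U i \<subseteq> cyl (\<zeta> i) \<and>
      ennreal (\<epsilon> powr (t - \<delta>) * ms (\<zeta> i)) \<le> Metric_space.mdiam_powr dist\<^sub>X (U i) t + ennreal \<kappa>" ..
    have "X \<subseteq> (\<Union>i\<in>F. cyl (\<zeta> i))" using F(2) \<zeta> by blast
    then have "1 \<le> (\<Sum>i\<in>F. ms (\<zeta> i))" using \<zeta> by (intro cover_mass[OF F(1)]) auto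
    then have "ennreal (\<epsilon> powr (t - \<delta>)) \<le> ennreal (\<Sum>i\<in>F. \<epsilon> powr (t - \<delta>) * ms (\<zeta> i))"
      by (intro ennreal_leI) (simp add: sum_distrib_left[symmetric] mult_le_cancel_left1)
    also have "\<dots> = (\<Sum>i\<in>F. ennreal (\<epsilon> powr (t - \<delta>) * ms (\<zeta> i)))"
      using \<zeta> mass_pos by (intro sum_ennreal[symmetric]) (simp add: less_imp_le)
    also have "\<dots> \<le> (\<Sum>i\<in>F. Metric_space.mdiam_powr dist\<^sub>X (U i) t + ennreal \<kappa>)"
      using \<zeta> by (intro sum_mono) blast
    also have "\<dots> = s + (\<Sum>i\<in>F. ennreal \<kappa>)" by (simp add: sum.distrib s)
    also have "(\<Sum>i\<in>F. ennreal \<kappa>) = ennreal (\<Sum>i\<in>F. \<kappa>)" using \<kappa> by (intro sum_ennreal) simp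
    also have "(\<Sum>i\<in>F. \<kappa>) \<le> e" using e by (simp add: \<kappa>_def field_simps)
    finally show "ennreal (\<epsilon> powr (t - \<delta>)) \<le> s + ennreal e" by (simp add: add_left_mono ennreal_leI)
  qed
qed

section \<open>The critical exponent\<close>

lemma hausdorff_meas_zero:
  assumes "\<delta> < t"
  shows "Metric_space.hausdorff_meas dist\<^sub>X t X = 0"
proof -
  have "\<forall>\<^sub>F \<epsilon> in at_right (0::real). Metric_space.hausdorff_pre dist\<^sub>X t \<epsilon> X = 0"
    unfolding eventually_at_right_field using hausdorff_pre_zero[OF assms] by (intro exI[of _ 1]) simp
  then have "((\<lambda>\<epsilon>. Metric_space.hausdorff_pre dist\<^sub>X t \<epsilon> X) \<longlongrightarrow> 0) (at_right 0)"
    by (rule tendsto_eventually)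
  then show ?thesis
    unfolding Metric_space.hausdorff_meas_def[OF metric_X] by (intro tendsto_Lim) simp_all
qed

lemma hausdorff_meas_top:
  assumes "0 \<le> t" "t < \<delta>"
  shows "Metric_space.hausdorff_meas dist\<^sub>X t X = \<infinity>"
proof -
  have "((\<lambda>\<epsilon>. ennreal (\<epsilon> powr (t - \<delta>))) \<longlongrightarrow> \<infinity>) (at_right 0)"
    unfolding infinity_ennreal_def ennreal_tendsto_top_eq_at_top using assms by (intro filterlim_powr_neg_at_right_0) simp
  moreover have "\<forall>\<^sub>F \<epsilon> in at_right (0::real). ennreal (\<epsilon> powr (t - \<delta>)) \<le> Metric_space.hausdorff_pre dist\<^sub>X t \<epsilon> X"
    unfolding eventually_at_right_field using hausdorff_pre_ge[OF _ _ assms] by (intro exI[of _ 1]) simp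
  ultimately have "((\<lambda>\<epsilon>. Metric_space.hausdorff_pre dist\<^sub>X t \<epsilon> X) \<longlongrightarrow> \<infinity>) (at_right 0)"
    by (rule tendsto_sandwich[OF _ _ _ tendsto_const, rotated 2]) simp
  then show ?thesis
    unfolding Metric_space.hausdorff_meas_def[OF metric_X]
    by (intro tendsto_Lim) simp_all
qed

lemma hausdorff_dimension: "Metric_space.has_hausdorff_dimension X dist\<^sub>X \<delta>"
  unfolding Metric_space.has_hausdorff_dimension_def[OF metric_X]
proof (intro conjI allI impI)
  show "Metric_space.critical_exponent X dist\<^sub>X \<delta>"
    unfolding Metric_space.critical_exponent_def[OF metric_X]
    using \<delta>_pos hausdorff_meas_top hausdorff_meas_zero by simp
  fix s assume "Metric_space.critical_exponent X dist\<^sub>X s"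
  then have s: "0 \<le> s" "\<And>t. 0 \<le> t \<Longrightarrow> t < s \<Longrightarrow> Metric_space.hausdorff_meas dist\<^sub>X t X = \<infinity>"
      "\<And>t. s < t \<Longrightarrow> Metric_space.hausdorff_meas dist\<^sub>X t X = 0"
    unfolding Metric_space.critical_exponent_def[OF metric_X] by blast+
  \<comment> \<open>At an exponent strictly between two distinct critical values the measure would
    be both 0 and infinite.\<close>
  show "s = \<delta>"
  proof (rule linorder_cases)
    assume "s < \<delta>"
    then obtain t where "s < t" "t < \<delta>" using dense by blast
    then show ?thesis using s(1,3) hausdorff_meas_top[of t] by simp
  next
    assume "\<delta> < s"
    then obtain t where "\<delta> < t" "t < s" using dense by blast
    then show ?thesis using s(2)[of t] \<delta>_pos hausdorff_meas_zero[of t] by simp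
  qed
qed

end

theorem corollary3p13:
  fixes k :: nat and \<Lambda> :: "'m kgraph" and \<delta> :: real
  assumes "k \<ge> 1"
    and "k_graph k \<Lambda>"
    and "arrows \<Lambda> \<noteq> {}"
    and "finite_kgraph k \<Lambda>"
    and "strongly_connected \<Lambda>"
    and "0 < \<delta>" and "\<delta> < 1"
    and "\<forall>\<eta> \<in> fin_paths k \<Lambda>.
           ennreal (weight k \<Lambda> \<delta> \<eta>) =
           Metric_space.mdiam (path_dist k \<Lambda> \<delta>) (cylinder k \<Lambda> \<eta>)"
  shows "Metric_space.has_hausdorff_dimension (inf_paths k \<Lambda>) (path_dist k \<Lambda> \<delta>) \<delta>"
proof -
  interpret diam_kgraph k \<Lambda> \<delta>
    using assms by unfold_locales blast+
  show ?thesis by (rule hausdorff_dimension)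
qed

end
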